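(* For every $d\ge1$ there are constants $C_d,N_d>0$ such that for every centered, isotropic, log-concave density $f$ on $\mathbb{R}^d$ with $\mathrm{Cov}(f)=\sigma^2I_d$ and $\sigma\ge N_d$, $$\left|\det\bigl(\mathrm{Cov}_{\mathbb{Z}^d}(f)\bigr)-\sigma^{2d}\right|\le C_d\,\sigma^{2d-1}.$$
   Context: A density $f$ on $\mathbb{R}^d$ is log-concave if $f=e^{-V}$ with $V:\mathbb{R}^d\to\mathbb{R}\cup\{+\infty\}$ convex; centered if $\int xf(x)dx=0$; isotropic if its (continuous) covariance matrix $\mathrm{Cov}(f)$ is $\sigma^2I_d$ for some $\sigma>0$. The discrete covariance matrix of $f$ is $[\mathrm{Cov}_{\mathbb{Z}^d}(f)]_{ij}=\frac{\sum_{k\in\mathbb{Z}^d}k_ik_jf(k)}{\sum_{k}f(k)}-\frac{\sum_kk_if(k)\sum_kk_jf(k)}{(\sum_kf(k))^2}$. *)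

theory Defs
  imports "HOL-Analysis.Analysis"
begin

text \<open>Convexity for functions with values in the extended reals omitting \<open>-\<infinity>\<close>.
  On \<^typ>\<open>ereal\<close> we have \<open>0 * \<infinity> = 0\<close>, so the end points \<open>t = 0\<close> and \<open>t = 1\<close> impose no condition.\<close>

definition convex_ereal :: "('a::real_vector \<Rightarrow> ereal) \<Rightarrow> bool" where
  "convex_ereal V \<longleftrightarrow>
     (\<forall>x. V x \<noteq> -\<infinity>) \<and>
     (\<forall>x y. \<forall>t\<in>{0..1::real}.
        V ((1 - t) *\<^sub>R x + t *\<^sub>R y) \<le> ereal (1 - t) * V x + ereal t * V y)"

text \<open>The value \<open>e\<^sup>-\<^sup>v\<close>, with \<open>e\<^sup>-\<^sup>\<infinity> = 0\<close>; only used for \<open>v \<noteq> -\<infinity>\<close>.\<close>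

definition exp_neg :: "ereal \<Rightarrow> real" where
  "exp_neg v = (if v = \<infinity> then 0 else exp (- real_of_ereal v))"

definition log_concave :: "('a::real_vector \<Rightarrow> real) \<Rightarrow> bool" where
  "log_concave f \<longleftrightarrow> (\<exists>V. convex_ereal V \<and> (\<forall>x. f x = exp_neg (V x)))"

text \<open>Integration is with respect to the completed Lebesgue measure: a log-concave function is
  always Lebesgue measurable, but need not be Borel measurable on the boundary of its support.\<close>

definition density_fun :: "('a::euclidean_space \<Rightarrow> real) \<Rightarrow> bool" where
  "density_fun f \<longleftrightarrow>
     (\<forall>x. 0 \<le> f x) \<and> integrable lebesgue f \<and> (LINT x|lebesgue. f x) = 1"

definition centered :: "('a::euclidean_space \<Rightarrow> real) \<Rightarrow> bool" where
  "centered f \<longleftrightarrow> (LINT x|lebesgue. f x *\<^sub>R x) = 0"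

definition cov :: "(real^'d \<Rightarrow> real) \<Rightarrow> real^'d^'d" where
  "cov f = (\<chi> i j.
     (LINT x|lebesgue. x $ i * x $ j * f x)
     - (LINT x|lebesgue. x $ i * f x) * (LINT x|lebesgue. x $ j * f x))"

definition isotropic :: "(real^'d \<Rightarrow> real) \<Rightarrow> bool" where
  "isotropic f \<longleftrightarrow> (\<exists>\<sigma>>0. cov f = mat (\<sigma>\<^sup>2))"

definition int_lattice :: "(real^'d) set" where
  "int_lattice = {k. \<forall>i. k $ i \<in> \<int>}"

definition discrete_cov :: "(real^'d \<Rightarrow> real) \<Rightarrow> real^'d^'d" where
  "discrete_cov f = (\<chi> i j.
     (\<Sum>\<^sub>\<infinity>k\<in>int_lattice. k $ i * k $ j * f k) / (\<Sum>\<^sub>\<infinity>k\<in>int_lattice. f k)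
     - ((\<Sum>\<^sub>\<infinity>k\<in>int_lattice. k $ i * f k) * (\<Sum>\<^sub>\<infinity>k\<in>int_lattice. k $ j * f k))
       / (\<Sum>\<^sub>\<infinity>k\<in>int_lattice. f k)\<^sup>2)"

end

theory Submission
  imports Defs
begin

text \<open>Everything reduces to lattice sums of \<open>(v \<bullet> k + s)\<^sup>2 * f k\<close>, since the moments of order at
  most two are differences of such sums; these have nonnegative terms, so two-sided pointwise
  bounds for \<open>f\<close> suffice. A lattice sum is the integral of the summand at the rounded-down point
  \<open>floor_vec x\<close>. If \<open>f\<close> is at least \<open>\<delta>\<close> times its supremum on a ball of radius \<open>r * \<sigma>\<close> about \<open>0\<close>, then
  log-concavity gives \<open>f ((1 - \<epsilon>) x + u) \<ge> \<delta>\<^sup>\<epsilon> f x\<close> whenever \<open>norm u \<le> \<epsilon> * r * \<sigma>\<close>. With \<open>\<epsilon>\<close> of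
  order \<open>1 / \<sigma>\<close> all rounding vectors \<open>u\<close> are admissible, and
  \<open>f (floor_vec x)\<close> is trapped between \<open>(1 - O(1/\<sigma>)) f (x / (1 - \<epsilon>))\<close> and
  \<open>(1 + O(1/\<sigma>)) f ((1 - \<epsilon>) x)\<close>, whose moments are known by scaling.

  The lower bound on the ball uses only contractions \<open>x \<mapsto> (x + y) / 2\<close>: they show
  \<open>sqrt (f y) * (LINT x|lebesgue. sqrt (f x)) \<le> 2\<^sup>d\<close>, which bounds the mass of small values of \<open>f\<close>.\<close>

subsection \<open>Log-concave functions\<close>

lemma
  fixes g :: "'a::euclidean_space \<Rightarrow> real"
  assumes c: "c \<noteq> 0" and g: "integrable lebesgue g"
  shows integrable_lebesgue_affine: "integrable lebesgue (\<lambda>x. g (t + c *\<^sub>R x))"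
    and integral_lebesgue_affine:
      "(LINT x|lebesgue. g (t + c *\<^sub>R x)) = (LINT x|lebesgue. g x) / \<bar>c\<bar> ^ DIM('a)"
proof -
  \<comment> \<open>Written coordinatewise to match the form of
    \<open>lebesgue_affine_euclidean\<close>.\<close>
  define T where "T = (\<lambda>x::'a. t + (\<Sum>j\<in>Basis. (c * (x \<bullet> j)) *\<^sub>R j))"
  have T: "T = (\<lambda>x. t + c *\<^sub>R x)"
    unfolding T_def scaleR_scaleR[symmetric] scaleR_sum_right[symmetric] euclidean_representation ..
  have T_meas [measurable]: "T \<in> lebesgue \<rightarrow>\<^sub>M lebesgue"
    unfolding T_def by (rule lebesgue_affine_measurable) (use c in auto)
  have leb: "lebesgue = density (distr lebesgue lebesgue T) (\<lambda>_. \<bar>c\<bar> ^ DIM('a))"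
    unfolding T_def using lebesgue_affine_euclidean[of "\<lambda>_. c" t] c by simp
  have g_meas [measurable]: "g \<in> borel_measurable lebesgue"
    using g by (rule borel_measurable_integrable)
  have "integrable (density (distr lebesgue lebesgue T) (\<lambda>_. \<bar>c\<bar> ^ DIM('a))) g"
    using g leb by simp
  then have "integrable (distr lebesgue lebesgue T) (\<lambda>x. \<bar>c\<bar> ^ DIM('a) *\<^sub>R g x)"
    by (subst (asm) integrable_density) auto
  then have "integrable lebesgue (\<lambda>x. \<bar>c\<bar> ^ DIM('a) *\<^sub>R g (T x))"
    by (subst (asm) integrable_distr_eq) auto
  then show "integrable lebesgue (\<lambda>x. g (t + c *\<^sub>R x))"
    using c by (simp add: T)
  have "(LINT x|lebesgue. g x)
      = (LINT x|density (distr lebesgue lebesgue T) (\<lambda>_. \<bar>c\<bar> ^ DIM('a)). g x)"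
    using leb by simp
  also have "\<dots> = (LINT x|distr lebesgue lebesgue T. \<bar>c\<bar> ^ DIM('a) *\<^sub>R g x)"
    by (subst integral_density) auto
  also have "\<dots> = (LINT x|lebesgue. \<bar>c\<bar> ^ DIM('a) *\<^sub>R g (T x))"
    by (subst integral_distr) auto
  finally show "(LINT x|lebesgue. g (t + c *\<^sub>R x)) = (LINT x|lebesgue. g x) / \<bar>c\<bar> ^ DIM('a)"
    using c by (simp add: T)
qed

lemma log_concave_nonneg: "log_concave f \<Longrightarrow> 0 \<le> f x"
  unfolding log_concave_def exp_neg_def by auto

text \<open>Convexity of \<open>V\<close>, exponentiated. Where \<open>V\<close> is infinite the
  left side vanishes because a zero base makes \<open>powr\<close> zero.\<close>

lemma log_concave_powr:
  assumes "log_concave f" "0 < t" "t < 1"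
  shows "f x powr (1 - t) * f y powr t \<le> f ((1 - t) *\<^sub>R x + t *\<^sub>R y)"
proof -
  obtain V where V: "convex_ereal V" "\<And>x. f x = exp_neg (V x)"
    using assms(1) unfolding log_concave_def by blast
  define m where "m = (1 - t) *\<^sub>R x + t *\<^sub>R y"
  have m: "V m \<le> ereal (1 - t) * V x + ereal t * V y" and mi: "V m \<noteq> -\<infinity>"
    using V(1) assms(2,3) unfolding convex_ereal_def m_def by auto
  show ?thesis
  proof (cases "V x = \<infinity> \<or> V y = \<infinity>")
    case True
    then have "f x = 0 \<or> f y = 0" by (auto simp: V(2) exp_neg_def)
    then show ?thesis using log_concave_nonneg[OF assms(1)] by auto
  next
    case False
    then obtain a b where ab: "V x = ereal a" "V y = ereal b"
      using V(1) unfolding convex_ereal_def by (metis ereal_cases)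
    have m2: "V m \<le> ereal ((1 - t) * a + t * b)" using m ab by simp
    then obtain e where e: "V m = ereal e" "e \<le> (1 - t) * a + t * b"
      using mi by (cases "V m") auto
    have "f x powr (1 - t) * f y powr t = exp (-((1 - t) * a + t * b))"
      by (simp add: V(2) ab exp_neg_def powr_def mult_exp_exp algebra_simps)
    also have "\<dots> \<le> exp (- e)" using e by simp
    finally show ?thesis by (simp add: V(2) e(1) exp_neg_def flip: m_def)
  qed
qed

lemma log_concave_sqrt:
  assumes "log_concave f"
  shows "sqrt (f x) * sqrt (f y) \<le> f ((1/2) *\<^sub>R x + (1/2) *\<^sub>R y)"
  using log_concave_powr[OF assms, of "1/2" x y] log_concave_nonneg[OF assms]
  by (simp add: powr_half_sqrt)

lemma convex_superlevel_log_concave: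
  assumes "log_concave f"
  shows "convex {x. a \<le> f x}"
proof (cases "0 < a")
  case False
  then have "{x. a \<le> f x} = UNIV" using log_concave_nonneg[OF assms] by (auto simp: not_less intro: order_trans)
  then show ?thesis by simp
next
  case True
  show ?thesis
    unfolding convex_alt
  proof (clarsimp)
    fix x y and t :: real
    assume *: "a \<le> f x" "a \<le> f y" "0 \<le> t" "t \<le> 1"
    show "a \<le> f ((1 - t) *\<^sub>R x + t *\<^sub>R y)"
    proof (cases "t = 0 \<or> t = 1")
      case False
      then have t: "0 < t" "t < 1" using * by auto
      have "a = a powr (1 - t) * a powr t" using True by (simp flip: powr_add)
      also have "\<dots> \<le> f x powr (1 - t) * f y powr t"
        using * t True by (intro mult_mono powr_mono2) auto
      also have "\<dots> \<le> f ((1 - t) *\<^sub>R x + t *\<^sub>R y)" by (rule log_concave_powr[OF assms t])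
      finally show ?thesis .
    qed (use * in auto)
  qed
qed

subsection \<open>Isotropic log-concave densities near the origin\<close>

text \<open>Equals \<open>\<eta> * s / \<sigma>\<close> for the parameters chosen in
  \<open>abs_linear_lower_bound\<close>: \<open>72 * 5 = 360\<close>.\<close>

definition mean_const :: "nat \<Rightarrow> real"
  where "mean_const d = 1 / (360 * 8 ^ d)"

text \<open>The square of the \<open>k\<close> in \<open>lower_bound_near_origin\<close>, where
  \<open>sqrt (f x)\<close> is what gets bounded. The denominator \<open>16 * 2 ^ d\<close> makes
  the last error term there integrate to \<open>c / 4 * \<sigma>\<close>, with
  \<open>c = mean_const d\<close>.\<close>

definition level_const :: "nat \<Rightarrow> real"
  where "level_const d = ((mean_const d)\<^sup>2 / (16 * 2 ^ d))\<^sup>2"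

lemma mean_const_pos: "0 < mean_const d"
  by (simp add: mean_const_def)

lemma level_const_pos: "0 < level_const d"
  using mean_const_pos[of d] by (simp add: level_const_def)

text \<open>Centering and isotropy are expressed through linear functionals, without coordinates.
  Integrability accompanies the moment equations because a non-integrable function has integral
  \<open>0\<close> by convention.\<close>

locale log_concave_isotropic =
  fixes f :: "'a::euclidean_space \<Rightarrow> real" and \<sigma> :: real
  assumes density: "density_fun f"
    and log_concave: "log_concave f"
    and \<sigma>_pos: "0 < \<sigma>"
    and integrable_linear: "integrable lebesgue (\<lambda>x. v \<bullet> x * f x)"
    and mean_zero: "(LINT x|lebesgue. v \<bullet> x * f x) = 0"
    and integrable_square: "integrable lebesgue (\<lambda>x. (v \<bullet> x)\<^sup>2 * f x)"
    and second_moment: "(LINT x|lebesgue. (v \<bullet> x)\<^sup>2 * f x) = (norm v)\<^sup>2 * \<sigma>\<^sup>2"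
begin

lemma nonneg: "0 \<le> f x"
  and integrable_f: "integrable lebesgue f"
  and integral_f: "(LINT x|lebesgue. f x) = 1"
  using density unfolding density_fun_def by auto

lemma measurable_f [measurable]: "f \<in> borel_measurable lebesgue"
  using integrable_f by (rule borel_measurable_integrable)

lemma exists_pos: "\<exists>x. 0 < f x"
proof (rule ccontr)
  assume "\<not> ?thesis"
  then have "f = (\<lambda>_. 0)" using nonneg by (auto simp: fun_eq_iff not_less intro: antisym)
  then show False using integral_f by simp
qed

lemma integrable_abs_linear: "integrable lebesgue (\<lambda>x. \<bar>v \<bullet> x\<bar> * f x)"
  using integrable_abs[OF integrable_linear[of v]] nonneg by (simp add: abs_mult)

lemma
  shows integrable_midpoint: "integrable lebesgue (\<lambda>x. f ((1/2) *\<^sub>R y + (1/2) *\<^sub>R x))"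
    and integral_midpoint: "(LINT x|lebesgue. f ((1/2) *\<^sub>R y + (1/2) *\<^sub>R x)) = 2 ^ DIM('a)"
  using integrable_lebesgue_affine[OF _ integrable_f, of "1/2" "(1/2) *\<^sub>R y"]
    integral_lebesgue_affine[OF _ integrable_f, of "1/2" "(1/2) *\<^sub>R y"] integral_f
  by (simp_all add: power_divide)

text \<open>For a fixed \<open>y\<close> with \<open>f y > 0\<close>, the midpoint inequality
  dominates \<open>sqrt (f x)\<close> by a multiple of \<open>f\<close> at the midpoint of
  \<open>x\<close> and \<open>y\<close>.\<close>

lemma integrable_sqrt: "integrable lebesgue (\<lambda>x. sqrt (f x))"
proof -
  obtain y where y: "0 < f y" using exists_pos ..
  have "integrable lebesgue (\<lambda>x. sqrt (f y) * sqrt (f x))"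
    using integrable_midpoint[of y]
  proof (rule Bochner_Integration.integrable_bound)
    show "AE x in lebesgue. norm (sqrt (f y) * sqrt (f x)) \<le> norm (f ((1/2) *\<^sub>R y + (1/2) *\<^sub>R x))"
      using log_concave_sqrt[OF log_concave] nonneg by auto
  qed measurable
  then show ?thesis using y by simp
qed

text \<open>The factor \<open>2 ^ DIM('a)\<close> is the Jacobian of \<open>x \<mapsto> (x + y) / 2\<close>.\<close>

definition "M = (2 ^ DIM('a) / (LINT x|lebesgue. sqrt (f x)))\<^sup>2"

text \<open>\<open>M\<close> stands in for the supremum of \<open>f\<close>. Integrating the
  midpoint inequality over one of its two points gives \<open>le_M\<close>;
  \<open>integral_sqrt\<close> later turns terms \<open>sqrt M * sqrt (f x)\<close> into absolute
  constants.\<close>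

lemma
  shows M_pos: "0 < M"
    and integral_sqrt: "sqrt M * (LINT x|lebesgue. sqrt (f x)) = 2 ^ DIM('a)"
    and le_M: "f x \<le> M"
proof -
  let ?I = "LINT x|lebesgue. sqrt (f x)"
  have "?I \<noteq> 0"
  proof
    assume "?I = 0"
    then have "AE x in lebesgue. sqrt (f x) = 0"
      using integral_nonneg_eq_0_iff_AE[OF integrable_sqrt] nonneg by auto
    then have "AE x in lebesgue. f x = 0" by simp
    then have "(LINT x|lebesgue. f x) = 0" by (rule integral_eq_zero_AE)
    then show False using integral_f by simp
  qed
  moreover have "0 \<le> ?I" using nonneg by (intro integral_nonneg_AE) auto
  ultimately have I: "0 < ?I" by simp
  show "0 < M" using I by (simp add: M_def)
  show "sqrt M * ?I = 2 ^ DIM('a)" using I by (simp add: M_def)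
  have "sqrt (f x) * ?I = (LINT y|lebesgue. sqrt (f x) * sqrt (f y))" by simp
  also have "\<dots> \<le> (LINT y|lebesgue. f ((1/2) *\<^sub>R x + (1/2) *\<^sub>R y))"
    using integrable_sqrt integrable_midpoint log_concave_sqrt[OF log_concave]
    by (intro integral_mono) auto
  also have "\<dots> = 2 ^ DIM('a)" by (rule integral_midpoint)
  finally have "sqrt (f x) \<le> 2 ^ DIM('a) / ?I" using I by (simp add: field_simps)
  then show "f x \<le> M" unfolding M_def using nonneg real_le_lsqrt sqrt_le_D by blast
qed

text \<open>If \<open>\<bar>v \<bullet> x\<bar>\<close> had a small mean, then \<open>f\<close> would be concentrated on the slab
  \<open>\<bar>v \<bullet> x\<bar> \<le> s\<close>. Contracting the slab towards a point outside of \<open>\<bar>v \<bullet> x\<bar> \<le> 3 * s\<close> shows that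
  \<open>f\<close> is small there, and contracting the outside towards a point of the slab with a large value
  of \<open>f\<close> then bounds the second moment.\<close>

lemma abs_linear_lower_bound:
  assumes "norm v = 1"
  shows "mean_const DIM('a) * \<sigma> \<le> (LINT x|lebesgue. \<bar>v \<bullet> x\<bar> * f x)"
proof (rule ccontr)
  define a where "a = (LINT x|lebesgue. \<bar>v \<bullet> x\<bar> * f x)"
  define s where "s = \<sigma> / 5"
  define \<eta> :: real where "\<eta> = 1 / (72 * 8 ^ DIM('a))"
  have s: "0 < s" using \<sigma>_pos by (simp add: s_def)
  have \<eta>: "0 < \<eta>" "\<eta> \<le> 1/72"
    unfolding \<eta>_def by (auto simp: field_simps)
  assume "\<not> ?thesis"
  then have "a < \<eta> * s" by (simp add: a_def \<eta>_def s_def mean_const_def)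
  then have as: "a / s < \<eta>" using s by (simp add: field_simps)
  note sqrt_ineq = log_concave_sqrt[OF log_concave]
  \<comment> \<open>Some point of the slab has a value comparable to \<open>M\<close>. Otherwise the
    slab would carry mass at most \<open>1/2\<close> by \<open>integral_sqrt\<close>, its complement
    at most \<open>a / s\<close> by Markov's inequality, and the total would stay below
    \<open>1\<close>.\<close>
  obtain z where z: "\<bar>v \<bullet> z\<bar> \<le> s" "sqrt M / 2 ^ (DIM('a) + 1) \<le> sqrt (f z)"
  proof (rule ccontr)
    assume "\<not> thesis"
    with that have *: "sqrt (f x) < sqrt M / 2 ^ (DIM('a) + 1)" if "\<bar>v \<bullet> x\<bar> \<le> s" for x
      using that by (meson not_less)
    have "f x \<le> sqrt M / 2 ^ (DIM('a) + 1) * sqrt (f x) + (\<bar>v \<bullet> x\<bar> * f x) / s" for x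
    proof (cases "\<bar>v \<bullet> x\<bar> \<le> s")
      case True
      have "f x = sqrt (f x) * sqrt (f x)" using nonneg by simp
      also have "\<dots> \<le> sqrt M / 2 ^ (DIM('a) + 1) * sqrt (f x)"
        using *[OF True] nonneg by (intro mult_right_mono) auto
      also have "\<dots> \<le> \<dots> + (\<bar>v \<bullet> x\<bar> * f x) / s" using nonneg s by simp
      finally show ?thesis .
    next
      case False
      then have "1 * f x \<le> \<bar>v \<bullet> x\<bar> / s * f x"
        using s nonneg by (intro mult_right_mono) (auto simp: field_simps)
      also have "\<dots> \<le> sqrt M / 2 ^ (DIM('a) + 1) * sqrt (f x) + \<dots>" using nonneg M_pos by simp
      finally show ?thesis by simp
    qed
    then have "(LINT x|lebesgue. f x)
        \<le> (LINT x|lebesgue. sqrt M / 2 ^ (DIM('a) + 1) * sqrt (f x) + (\<bar>v \<bullet> x\<bar> * f x) / s)"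
      using integrable_f integrable_sqrt integrable_abs_linear by (intro integral_mono) auto
    also have "\<dots> = sqrt M * (LINT x|lebesgue. sqrt (f x)) / 2 ^ (DIM('a) + 1) + a / s"
      using integrable_sqrt integrable_abs_linear by (simp add: a_def)
    also have "\<dots> = 1/2 + a / s" unfolding integral_sqrt by simp
    finally show False using as \<eta> integral_f by simp
  qed
  have far: "sqrt (f x) \<le> sqrt M * 2 ^ (DIM('a) + 1) * \<eta>" if x: "3 * s < \<bar>v \<bullet> x\<bar>" for x
  proof -
    define m where "m w = (1/2) *\<^sub>R x + (1/2) *\<^sub>R w" for w :: 'a
    \<comment> \<open>The factor \<open>f w - (\<bar>v \<bullet> w\<bar> * f w) / s\<close> replaces
      the restriction of \<open>f\<close> to the slab: it is at most \<open>f w\<close> everywhere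
      and nonpositive off the slab. For \<open>w\<close> in the slab the midpoint \<open>m w\<close>
      satisfies \<open>s \<le> \<bar>v \<bullet> m w\<bar>\<close>, so its contribution is paid for
      by the small mean \<open>a\<close>.\<close>
    have "sqrt (f x) * (f w - (\<bar>v \<bullet> w\<bar> * f w) / s) \<le> sqrt M / s * (\<bar>v \<bullet> m w\<bar> * f (m w))" for w
    proof (cases "\<bar>v \<bullet> w\<bar> \<le> s")
      case True
      have vm: "v \<bullet> m w = (v \<bullet> x + v \<bullet> w) / 2" by (simp add: m_def inner_add_right field_simps)
      have "2 * s \<le> \<bar>v \<bullet> x + v \<bullet> w\<bar>" using True x by linarith
      then have "s \<le> \<bar>v \<bullet> m w\<bar>" unfolding vm by simp
      then have 1: "1 \<le> \<bar>v \<bullet> m w\<bar> / s" using s by simp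
      have "sqrt (f x) * (f w - (\<bar>v \<bullet> w\<bar> * f w) / s) \<le> sqrt (f x) * f w"
        using nonneg s by (intro mult_left_mono) auto
      also have "\<dots> = sqrt (f w) * (sqrt (f x) * sqrt (f w))" using nonneg by simp
      also have "\<dots> \<le> sqrt M * f (m w)"
        using le_M nonneg sqrt_ineq M_pos unfolding m_def by (intro mult_mono) auto
      also have "\<dots> * 1 \<le> sqrt M * f (m w) * (\<bar>v \<bullet> m w\<bar> / s)"
        using 1 M_pos nonneg by (intro mult_left_mono) auto
      finally show ?thesis by (simp add: mult_ac)
    next
      case False
      then have "1 * f w \<le> \<bar>v \<bullet> w\<bar> / s * f w"
        using s nonneg by (intro mult_right_mono) (auto simp: field_simps)
      then have "sqrt (f x) * (f w - (\<bar>v \<bullet> w\<bar> * f w) / s) \<le> 0"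
        using nonneg by (intro mult_nonneg_nonpos) auto
      also have "\<dots> \<le> sqrt M / s * (\<bar>v \<bullet> m w\<bar> * f (m w))" using s M_pos nonneg by simp
      finally show ?thesis .
    qed
    then have "(LINT w|lebesgue. sqrt (f x) * (f w - (\<bar>v \<bullet> w\<bar> * f w) / s))
        \<le> (LINT w|lebesgue. sqrt M / s * (\<bar>v \<bullet> m w\<bar> * f (m w)))"
      using integrable_f integrable_abs_linear[of v]
        integrable_lebesgue_affine[OF _ integrable_abs_linear[of v], of "1/2" "(1/2) *\<^sub>R x"]
      unfolding m_def by (intro integral_mono) auto
    also have "\<dots> = sqrt M * 2 ^ DIM('a) * (a / s)"
      using integral_lebesgue_affine[OF _ integrable_abs_linear[of v], of "1/2" "(1/2) *\<^sub>R x"]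
      unfolding m_def a_def by (simp add: power_divide)
    also have "\<dots> \<le> sqrt M * 2 ^ DIM('a) * \<eta>"
      using as M_pos by (intro mult_left_mono) auto
    also have "(LINT w|lebesgue. sqrt (f x) * (f w - (\<bar>v \<bullet> w\<bar> * f w) / s)) = sqrt (f x) * (1 - a / s)"
      using integrable_f integrable_abs_linear integral_f by (simp add: a_def)
    finally have "sqrt (f x) * (1 - a / s) \<le> sqrt M * 2 ^ DIM('a) * \<eta>" .
    moreover have "sqrt (f x) * (1/2) \<le> sqrt (f x) * (1 - a / s)"
      using as \<eta> nonneg by (intro mult_left_mono) auto
    ultimately have "sqrt (f x) \<le> 2 * (sqrt M * 2 ^ DIM('a) * \<eta>)" by linarith
    then show ?thesis by simp
  qed
  \<comment> \<open>The coefficients come from \<open>(2 * p - q)^2 \<le> 8 * p^2 + 2 * q^2\<close>,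
    with \<open>p\<close> the value of \<open>v\<close> at the midpoint of \<open>z\<close> and
    \<open>x\<close>, and \<open>q = v \<bullet> z\<close> at most \<open>s\<close> in absolute
    value.\<close>
  define g where "g x = 8 * ((v \<bullet> x)\<^sup>2 * f x) + 2 * s\<^sup>2 * f x" for x
  have g_int: "integrable lebesgue g"
    unfolding g_def using integrable_square integrable_f by auto
  have g_eq: "(LINT x|lebesgue. g x) = 8 * \<sigma>\<^sup>2 + 2 * s\<^sup>2"
    unfolding g_def using integrable_square[of v] integrable_f integral_f second_moment[of v] assms
    by simp
  have "(v \<bullet> x)\<^sup>2 * f x \<le> 9 * s\<^sup>2 * f x + 4 ^ (DIM('a) + 1) * \<eta> * g ((1/2) *\<^sub>R z + (1/2) *\<^sub>R x)" for x
  proof (cases "3 * s < \<bar>v \<bullet> x\<bar>")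
    case False
    then have "\<bar>v \<bullet> x\<bar>\<^sup>2 \<le> (3 * s)\<^sup>2" by (intro power_mono) auto
    then have "(v \<bullet> x)\<^sup>2 * f x \<le> 9 * s\<^sup>2 * f x"
      using nonneg by (intro mult_right_mono) (auto simp: power_mult_distrib)
    moreover have "0 \<le> 4 ^ (DIM('a) + 1) * \<eta> * g ((1/2) *\<^sub>R z + (1/2) *\<^sub>R x)"
      unfolding g_def using nonneg \<eta> by simp
    ultimately show ?thesis by linarith
  next
    case True
    define m where "m = (1/2) *\<^sub>R z + (1/2) *\<^sub>R x"
    \<comment> \<open>One factor \<open>2 ^ (DIM('a) + 1)\<close> comes from the large value at
      \<open>z\<close>, a second one from \<open>far\<close>; hence
      \<open>4 ^ (DIM('a) + 1)\<close>.\<close>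
    have "sqrt M * sqrt (f x) \<le> 2 ^ (DIM('a) + 1) * sqrt (f z) * sqrt (f x)"
      using z nonneg by (intro mult_right_mono) (auto simp: field_simps)
    also have "\<dots> \<le> 2 ^ (DIM('a) + 1) * f m"
      using sqrt_ineq[of z x] unfolding m_def by simp
    finally have 1: "sqrt M * sqrt (f x) \<le> 2 ^ (DIM('a) + 1) * f m" .
    have "f x = sqrt (f x) * sqrt (f x)" using nonneg by simp
    also have "\<dots> \<le> sqrt M * 2 ^ (DIM('a) + 1) * \<eta> * sqrt (f x)"
      using far[OF True] nonneg by (intro mult_right_mono) auto
    also have "\<dots> = 2 ^ (DIM('a) + 1) * \<eta> * (sqrt M * sqrt (f x))" by simp
    also have "\<dots> \<le> 2 ^ (DIM('a) + 1) * \<eta> * (2 ^ (DIM('a) + 1) * f m)"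
      using 1 \<eta> by (intro mult_left_mono) auto
    also have "\<dots> = 4 ^ (DIM('a) + 1) * \<eta> * f m"
      by (simp flip: power_mult_distrib)
    finally have fx: "f x \<le> 4 ^ (DIM('a) + 1) * \<eta> * f m" .
    have vx: "v \<bullet> x = 2 * (v \<bullet> m) - v \<bullet> z" by (simp add: m_def inner_add_right field_simps)
    have "(v \<bullet> z)\<^sup>2 \<le> s\<^sup>2" using power_mono[OF z(1), of 2] by simp
    moreover have "0 \<le> (2 * (v \<bullet> m) + v \<bullet> z)\<^sup>2" by simp
    ultimately have 2: "(v \<bullet> x)\<^sup>2 \<le> 8 * (v \<bullet> m)\<^sup>2 + 2 * s\<^sup>2"
      unfolding vx by (simp add: power2_eq_square algebra_simps)
    have "(v \<bullet> x)\<^sup>2 * f x \<le> (8 * (v \<bullet> m)\<^sup>2 + 2 * s\<^sup>2) * (4 ^ (DIM('a) + 1) * \<eta> * f m)"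
      using fx 2 nonneg by (intro mult_mono) auto
    also have "\<dots> = 4 ^ (DIM('a) + 1) * \<eta> * g m" by (simp add: g_def algebra_simps)
    also have "\<dots> \<le> 9 * s\<^sup>2 * f x + \<dots>" using nonneg by simp
    finally show ?thesis unfolding m_def .
  qed
  then have "(LINT x|lebesgue. (v \<bullet> x)\<^sup>2 * f x)
    \<le> (LINT x|lebesgue. 9 * s\<^sup>2 * f x + 4 ^ (DIM('a) + 1) * \<eta> * g ((1/2) *\<^sub>R z + (1/2) *\<^sub>R x))"
    using integrable_square integrable_f integrable_lebesgue_affine[OF _ g_int]
    by (intro integral_mono) auto
  also have "\<dots> = 9 * s\<^sup>2 + 4 ^ (DIM('a) + 1) * \<eta> * (2 ^ DIM('a) * (8 * \<sigma>\<^sup>2 + 2 * s\<^sup>2))"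
    using integrable_f integrable_lebesgue_affine[OF _ g_int, of "1/2" "(1/2) *\<^sub>R z"] integral_f
      integral_lebesgue_affine[OF _ g_int, of "1/2" "(1/2) *\<^sub>R z"]
    by (simp add: g_eq power_divide)
  \<comment> \<open>With the Jacobian \<open>2 ^ DIM('a)\<close> the powers combine to
    \<open>4 * 8 ^ DIM('a)\<close>, which \<eta> reduces to \<open>1/18\<close>. For
    \<open>s = \<sigma> / 5\<close> the whole bound is \<open>182/225 * \<sigma>^2\<close>, less
    than the second moment.\<close>
  also have "4 ^ (DIM('a) + 1) * \<eta> * (2 ^ DIM('a) * (8 * \<sigma>\<^sup>2 + 2 * s\<^sup>2)) = (8 * \<sigma>\<^sup>2 + 2 * s\<^sup>2) / 18"
  proof -
    have "(4::real) ^ DIM('a) * 2 ^ DIM('a) = 8 ^ DIM('a)" by (simp flip: power_mult_distrib)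
    then have "4 ^ (DIM('a) + 1) * \<eta> * 2 ^ DIM('a) = 1/18"
      by (simp add: \<eta>_def field_simps)
    then show ?thesis by (simp add: mult.assoc[symmetric])
  qed
  finally show False using \<sigma>_pos assms by (simp add: second_moment s_def power_divide)
qed

text \<open>Here the centering enters: if \<open>f\<close> were small at a point near the origin, it
  would be small on a half-space, so \<open>v \<bullet> x\<close> would have a small positive part, hence a small
  absolute mean.\<close>

lemma lower_bound_near_origin:
  assumes b: "norm b \<le> mean_const DIM('a) / 8 * \<sigma>"
  shows "level_const DIM('a) * M \<le> f b"
proof (rule ccontr)
  define c where "c = mean_const DIM('a)"
  define k where "k = c\<^sup>2 / (16 * 2 ^ DIM('a))"
  have c: "0 < c" by (simp add: c_def mean_const_pos)
  then have k: "0 < k" by (simp add: k_def)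
  define K where "K = {x. k\<^sup>2 * M \<le> f x}"
  assume "\<not> ?thesis"
  then have bK: "b \<notin> K" by (simp add: K_def k_def level_const_def c_def)
  have cK: "convex K" unfolding K_def by (rule convex_superlevel_log_concave[OF log_concave])
  \<comment> \<open>The half-space comes from separating \<open>b\<close> from the convex superlevel
    set; if that set is empty, any unit vector serves.\<close>
  obtain v where v: "norm v = 1" "\<And>x. x \<in> K \<Longrightarrow> v \<bullet> x \<le> v \<bullet> b"
  proof (cases "K = {}")
    case True
    obtain e :: 'a where "e \<in> Basis" using nonempty_Basis by blast
    then show thesis using that[of e] True by auto
  next
    case False
    obtain w \<beta> where w: "w \<noteq> 0" "\<And>x. x \<in> K \<Longrightarrow> w \<bullet> x \<le> \<beta>" "\<beta> \<le> w \<bullet> b"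
      using separating_hyperplane_sets[of K "{b}"] cK False bK by auto
    show thesis
    proof (rule that[of "w /\<^sub>R norm w"])
      show "norm (w /\<^sub>R norm w) = 1" using w(1) by simp
      show "(w /\<^sub>R norm w) \<bullet> x \<le> (w /\<^sub>R norm w) \<bullet> b" if "x \<in> K" for x
        using w(2)[OF that] w(3) by (simp add: mult_left_mono)
    qed
  qed
  have vb: "v \<bullet> b \<le> c / 8 * \<sigma>"
    using norm_cauchy_schwarz[of v b] v(1) b by (simp add: c_def)
  \<comment> \<open>As \<open>\<bar>y\<bar> = - y + 2 * max y 0\<close> and \<open>- y\<close> will
    integrate to zero, only \<open>2 * y\<close> for positive \<open>y\<close> needs a bound:
    \<open>?A\<close> handles small \<open>y\<close>, and \<open>?B + ?C\<close> handles large
    \<open>y\<close>, where \<open>x\<close> lies outside \<open>K\<close>.\<close>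
  have "\<bar>v \<bullet> x\<bar> * f x \<le> - (v \<bullet> x * f x) + c / 4 * \<sigma> * f x + c / 4 / \<sigma> * ((v \<bullet> x)\<^sup>2 * f x)
      + \<sigma> * 4 / c * k * sqrt M * sqrt (f x)" (is "_ \<le> _ + ?A + ?B + ?C") for x
  proof -
    have ABC: "0 \<le> ?A" "0 \<le> ?B" "0 \<le> ?C" using c k \<sigma>_pos nonneg M_pos by auto
    consider "v \<bullet> x \<le> 0" | "0 < v \<bullet> x" "v \<bullet> x \<le> c / 8 * \<sigma>" | "0 < v \<bullet> x" "c / 8 * \<sigma> < v \<bullet> x"
      by linarith
    then show ?thesis
    proof cases
      case 1
      then show ?thesis using ABC by simp
    next
      case 2
      have "v \<bullet> x * f x \<le> c / 8 * \<sigma> * f x" using 2 nonneg by (intro mult_right_mono) auto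
      then show ?thesis unfolding abs_of_pos[OF 2(1)] using ABC by linarith
    next
      case 3
      then have "x \<notin> K" using v(2) vb by fastforce
      then have "sqrt (f x) \<le> sqrt (k\<^sup>2 * M)" by (intro real_sqrt_le_mono) (simp add: K_def)
      then have "sqrt (f x) \<le> k * sqrt M" using k by (simp add: real_sqrt_mult)
      then have "sqrt (f x) * sqrt (f x) \<le> k * sqrt M * sqrt (f x)"
        using nonneg by (intro mult_right_mono) auto
      then have fx: "f x \<le> k * sqrt M * sqrt (f x)" using nonneg by simp
      \<comment> \<open>The square is weighted so that its quadratic part integrates to
        \<open>c / 4 * \<sigma>\<close>. The constant left over is multiplied by \<open>f x\<close>,
        which is traded for \<open>k * sqrt M * sqrt (f x)\<close> off \<open>K\<close>.\<close>
      have "0 \<le> c / 4 / \<sigma> * (v \<bullet> x - 4 * \<sigma> / c)\<^sup>2" using c \<sigma>_pos by simp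
      also have "\<dots> = c / 4 / \<sigma> * (v \<bullet> x)\<^sup>2 - 2 * (v \<bullet> x) + \<sigma> * 4 / c"
        using c \<sigma>_pos by (simp add: power2_eq_square field_simps)
      finally have "2 * (v \<bullet> x) \<le> c / 4 / \<sigma> * (v \<bullet> x)\<^sup>2 + \<sigma> * 4 / c" by simp
      then have "2 * (v \<bullet> x) * f x \<le> (c / 4 / \<sigma> * (v \<bullet> x)\<^sup>2 + \<sigma> * 4 / c) * f x"
        using nonneg by (intro mult_right_mono) auto
      also have "\<dots> = ?B + \<sigma> * 4 / c * f x" by (simp add: algebra_simps)
      also have "\<sigma> * 4 / c * f x \<le> \<sigma> * 4 / c * (k * sqrt M * sqrt (f x))"
        using fx c \<sigma>_pos by (intro mult_left_mono) auto
      also have "\<dots> = ?C" by simp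
      finally show ?thesis unfolding abs_of_pos[OF 3(1)] using ABC by linarith
    qed
  qed
  then have "(LINT x|lebesgue. \<bar>v \<bullet> x\<bar> * f x) \<le> (LINT x|lebesgue.
      - (v \<bullet> x * f x) + c / 4 * \<sigma> * f x + c / 4 / \<sigma> * ((v \<bullet> x)\<^sup>2 * f x)
      + \<sigma> * 4 / c * k * sqrt M * sqrt (f x))"
    using integrable_abs_linear integrable_linear integrable_square integrable_f integrable_sqrt
    by (intro integral_mono Bochner_Integration.integrable_add integrable_mult_right
        Bochner_Integration.integrable_minus) auto
  also have "\<dots> = c / 4 * \<sigma> + c / 4 * \<sigma> + \<sigma> * 4 / c * k * (sqrt M * (LINT x|lebesgue. sqrt (f x)))"
    using integrable_linear[of v] integrable_square[of v] integrable_f integrable_sqrt integral_f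
      mean_zero[of v] second_moment[of v] v(1) \<sigma>_pos
    by (simp add: power2_eq_square)
  also have "\<dots> = 3 / 4 * c * \<sigma>"
    unfolding integral_sqrt using c by (simp add: k_def power2_eq_square)
  also have "\<dots> < c * \<sigma>" using c \<sigma>_pos by simp
  finally show False using abs_linear_lower_bound[OF v(1)] by (simp add: c_def)
qed

text \<open>Log-concavity between \<open>x\<close> and \<open>u /\<^sub>R \<epsilon>\<close>: the
  latter lies in the ball of \<open>lower_bound_near_origin\<close>, and \<open>le_M\<close> allows
  \<open>M\<close> to be replaced by \<open>f x\<close> there.\<close>

lemma contraction_bound:
  assumes \<epsilon>: "0 < \<epsilon>" "\<epsilon> < 1" and u: "norm u \<le> \<epsilon> * (mean_const DIM('a) / 8 * \<sigma>)"
  shows "level_const DIM('a) powr \<epsilon> * f x \<le> f ((1 - \<epsilon>) *\<^sub>R x + u)"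
proof (cases "f x = 0")
  case False
  then have fx: "0 < f x" using nonneg[of x] by simp
  let ?b = "u /\<^sub>R \<epsilon>"
  have "norm ?b \<le> mean_const DIM('a) / 8 * \<sigma>"
    using \<epsilon> u by (simp add: field_simps)
  from lower_bound_near_origin[OF this] have fb: "level_const DIM('a) * f x \<le> f ?b"
    using le_M[of x] level_const_pos by (meson mult_left_mono less_imp_le order_trans)
  have "level_const DIM('a) powr \<epsilon> * f x = f x powr (1 - \<epsilon>) * (level_const DIM('a) * f x) powr \<epsilon>"
    using fx level_const_pos by (simp add: powr_mult powr_diff)
  also have "\<dots> \<le> f x powr (1 - \<epsilon>) * f ?b powr \<epsilon>"
    using fb fx \<epsilon> level_const_pos[of "DIM('a)"]
    by (intro mult_left_mono powr_mono2) auto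
  also have "\<dots> \<le> f ((1 - \<epsilon>) *\<^sub>R x + u)"
    using log_concave_powr[OF log_concave \<epsilon>, of x ?b] \<epsilon> by simp
  finally show ?thesis .
qed (simp add: nonneg)

end

section \<open>Moments of linear functionals from the covariance matrix\<close>

lemma log_concave_isotropicI:
  fixes f :: "real^'d \<Rightarrow> real"
  assumes dens: "density_fun f" and lc: "log_concave f" and cent: "centered f"
    and cov: "cov f = mat (\<sigma>\<^sup>2)" and \<sigma>: "0 < \<sigma>"
  shows "log_concave_isotropic f \<sigma>"
proof -
  have nonneg: "0 \<le> f x" for x using dens by (simp add: density_fun_def)
  have int: "integrable lebesgue f" using dens by (simp add: density_fun_def)
  have meas [measurable]: "f \<in> borel_measurable lebesgue" using int by (rule borel_measurable_integrable)
  have [measurable]: "(\<lambda>x :: real^'d. x $ i) \<in> borel_measurable lebesgue" for i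
    by (rule measurable_completion) measurable
  have [measurable]: "(\<lambda>x. x) \<in> lebesgue \<rightarrow>\<^sub>M (borel :: (real^'d) measure)"
    by (rule measurable_completion) simp
  have cov_entry: "(LINT x|lebesgue. x $ i * x $ j * f x)
     - (LINT x|lebesgue. x $ i * f x) * (LINT x|lebesgue. x $ j * f x) = (if i = j then \<sigma>\<^sup>2 else 0)" for i j
    using cov by (simp add: cov_def mat_def vec_eq_iff)
  \<comment> \<open>Integrability is recovered from the covariance: a divergent integral counts as
    \<open>0\<close>, so the diagonal entry would be minus a square instead of the positive
    \<open>\<sigma>^2\<close>.\<close>
  have int_sq: "integrable lebesgue (\<lambda>x. x $ i * x $ i * f x)" for i
  proof (rule ccontr)
    assume "\<not> ?thesis"
    then have "(LINT x|lebesgue. x $ i * x $ i * f x) = 0" by (rule not_integrable_integral_eq)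
    with cov_entry[of i i] have "\<sigma>\<^sup>2 = - (LINT x|lebesgue. x $ i * f x)\<^sup>2"
      by (simp add: power2_eq_square)
    then show False using \<sigma> by (smt (verit) zero_le_power2 zero_less_power)
  qed
  have int_lin: "integrable lebesgue (\<lambda>x. x $ i * f x)" for i
  proof (rule Bochner_Integration.integrable_bound)
    show "integrable lebesgue (\<lambda>x. f x + x $ i * x $ i * f x)" using int int_sq by simp
    have "\<bar>y\<bar> \<le> 1 + y * y" for y :: real
      using zero_le_power2[of "\<bar>y\<bar> - 1"] by (simp add: power2_eq_square algebra_simps)
    then have "\<bar>x $ i\<bar> * f x \<le> (1 + x $ i * x $ i) * f x" for x
      by (rule mult_right_mono) (rule nonneg)
    then show "AE x in lebesgue. norm (x $ i * f x) \<le> norm (f x + x $ i * x $ i * f x)"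
      using nonneg by (auto simp: abs_mult algebra_simps intro: order_trans[OF _ abs_ge_self])
  qed measurable
  have int_mix: "integrable lebesgue (\<lambda>x. x $ i * x $ j * f x)" for i j
  proof (rule Bochner_Integration.integrable_bound)
    show "integrable lebesgue (\<lambda>x. x $ i * x $ i * f x + x $ j * x $ j * f x)" using int_sq by simp
    have "\<bar>a * b\<bar> \<le> a * a + b * b" for a b :: real
      using zero_le_power2[of "a - b"] zero_le_power2[of "a + b"]
      by (simp add: power2_eq_square algebra_simps abs_le_iff)
    then have "\<bar>x $ i * x $ j\<bar> * f x \<le> (x $ i * x $ i + x $ j * x $ j) * f x" for x
      by (rule mult_right_mono) (rule nonneg)
    then show "AE x in lebesgue. norm (x $ i * x $ j * f x)
        \<le> norm (x $ i * x $ i * f x + x $ j * x $ j * f x)"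
      using nonneg by (auto simp: abs_mult algebra_simps intro: order_trans[OF _ abs_ge_self])
  qed measurable
  have mean: "(LINT x|lebesgue. x $ i * f x) = 0" for i
  proof -
    \<comment> \<open>\<open>centered\<close> concerns a vector-valued integral, which must converge
      before coordinates can be taken inside.\<close>
    have "integrable lebesgue (\<lambda>x. f x *\<^sub>R x)"
    proof (rule Bochner_Integration.integrable_bound)
      show "integrable lebesgue (\<lambda>x. \<Sum>i\<in>UNIV. \<bar>x $ i * f x\<bar>)"
        using int_lin by auto
      have "norm (f x *\<^sub>R x) \<le> (\<Sum>i\<in>UNIV. \<bar>x $ i * f x\<bar>)" for x
        using norm_le_l1_cart[of "f x *\<^sub>R x"] by (simp add: mult.commute)
      then show "AE x in lebesgue. norm (f x *\<^sub>R x) \<le> norm (\<Sum>i\<in>UNIV. \<bar>x $ i * f x\<bar>)"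
        by (auto intro: order_trans[OF _ abs_ge_self])
    qed measurable
    then have "(LINT x|lebesgue. axis i 1 \<bullet> (f x *\<^sub>R x)) = axis i 1 \<bullet> (LINT x|lebesgue. f x *\<^sub>R x)"
      by (rule integral_inner_right)
    then show ?thesis using cent by (simp add: centered_def inner_axis' mult.commute)
  qed
  have lin: "(\<lambda>x. v \<bullet> x * f x) = (\<lambda>x. \<Sum>i\<in>UNIV. v $ i * (x $ i * f x))" for v :: "real^'d"
    by (auto simp: inner_vec_def sum_distrib_right mult.assoc)
  have quad: "(\<lambda>x. (v \<bullet> x)\<^sup>2 * f x)
      = (\<lambda>x. \<Sum>i\<in>UNIV. \<Sum>j\<in>UNIV. v $ i * v $ j * (x $ i * x $ j * f x))" for v :: "real^'d"
    unfolding inner_vec_def power2_eq_square sum_product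
    unfolding sum_distrib_right by (simp add: mult_ac)
  show ?thesis
  proof
    fix v :: "real^'d"
    show "integrable lebesgue (\<lambda>x. v \<bullet> x * f x)"
      unfolding lin using int_lin by auto
    show "(LINT x|lebesgue. v \<bullet> x * f x) = 0"
      unfolding lin using int_lin mean by simp
    show "integrable lebesgue (\<lambda>x. (v \<bullet> x)\<^sup>2 * f x)"
      unfolding quad using int_mix by auto
    have "(LINT x|lebesgue. (v \<bullet> x)\<^sup>2 * f x)
        = (\<Sum>i\<in>UNIV. \<Sum>j\<in>UNIV. v $ i * v $ j * (if i = j then \<sigma>\<^sup>2 else 0))"
      unfolding quad using int_mix cov_entry by (simp add: mean)
    also have "\<dots> = (norm v)\<^sup>2 * \<sigma>\<^sup>2"
      by (simp add: if_distrib[of "\<lambda>x. _ * x"] sum.delta power2_norm_eq_inner inner_vec_def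
          sum_distrib_right cong: if_cong)
    finally show "(LINT x|lebesgue. (v \<bullet> x)\<^sup>2 * f x) = (norm v)\<^sup>2 * \<sigma>\<^sup>2" .
  qed (use dens lc \<sigma> in auto)
qed

subsection \<open>Lattice sums as integrals\<close>

definition floor_vec :: "real^'d \<Rightarrow> real^'d"
  where "floor_vec x = (\<chi> i. of_int \<lfloor>x $ i\<rfloor>)"

lemma floor_vec_in_lattice: "floor_vec x \<in> int_lattice"
  by (simp add: floor_vec_def int_lattice_def)

lemma norm_diff_floor_vec: "norm (x - floor_vec x) \<le> CARD('d)" for x :: "real^'d"
proof -
  have "norm (x - floor_vec x) \<le> (\<Sum>i\<in>UNIV. \<bar>(x - floor_vec x) $ i\<bar>)" by (rule norm_le_l1_cart)
  also have "\<dots> \<le> (\<Sum>i\<in>(UNIV :: 'd set). 1)"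
    by (rule sum_mono) (simp add: floor_vec_def abs_if, linarith)
  finally show ?thesis by simp
qed

lemma countable_int_lattice: "countable (int_lattice :: (real^'d) set)"
proof -
  have "(int_lattice :: (real^'d) set) \<subseteq> range (\<lambda>h :: 'd \<Rightarrow> int. \<chi> i. of_int (h i))"
  proof
    fix k :: "real^'d" assume "k \<in> int_lattice"
    then have "k = (\<chi> i. of_int \<lfloor>k $ i\<rfloor>)"
      by (auto simp: int_lattice_def vec_eq_iff)
    then show "k \<in> range (\<lambda>h :: 'd \<Rightarrow> int. \<chi> i. of_int (h i))"
      by (intro image_eqI[where x="\<lambda>i. \<lfloor>k $ i\<rfloor>"]) auto
  qed
  then show ?thesis by (rule countable_subset) simp
qed

lemma vimage_floor_vec:
  assumes "k \<in> int_lattice"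
  shows "floor_vec -` {k} = {x. \<forall>i. k $ i \<le> x $ i \<and> x $ i < k $ i + 1}"
proof -
  have "of_int \<lfloor>x $ i\<rfloor> = k $ i \<longleftrightarrow> k $ i \<le> x $ i \<and> x $ i < k $ i + 1" for x :: "real^'a" and i
  proof -
    obtain m where m: "k $ i = of_int m" using assms by (auto simp: int_lattice_def Ints_def)
    show ?thesis unfolding m of_int_eq_iff floor_eq_iff ..
  qed
  then show ?thesis by (auto simp: floor_vec_def vec_eq_iff)
qed

lemma
  fixes k :: "real^'d"
  assumes k: "k \<in> int_lattice"
  shows sets_vimage_floor_vec: "floor_vec -` {k} \<in> sets lebesgue"
    and emeasure_vimage_floor_vec: "emeasure lebesgue (floor_vec -` {k}) = 1"
proof -
  have "{x :: real^'d. \<forall>i. k $ i \<le> x $ i \<and> x $ i < k $ i + 1} \<in> sets borel" by measurable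
  then have borel: "floor_vec -` {k} \<in> sets borel" by (simp only: vimage_floor_vec[OF k])
  then show "floor_vec -` {k} \<in> sets lebesgue" by simp
  \<comment> \<open>The half-open cube is squeezed between the open and the closed one, both of
    volume \<open>1\<close>.\<close>
  have "box k (k + 1) \<subseteq> floor_vec -` {k}" "floor_vec -` {k} \<subseteq> cbox k (k + 1)"
    unfolding vimage_floor_vec[OF k] by (auto simp: mem_box_cart less_imp_le)
  then have "emeasure lborel (box k (k + 1)) \<le> emeasure lborel (floor_vec -` {k})"
    "emeasure lborel (floor_vec -` {k}) \<le> emeasure lborel (cbox k (k + 1))"
    using borel by (auto intro!: emeasure_mono)
  moreover have one: "(1 :: real^'d) \<bullet> b = 1" if "b \<in> Basis" for b
    using that by (auto simp: Basis_vec_def inner_axis)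
  have "emeasure lborel (box k (k + 1)) = 1" "emeasure lborel (cbox k (k + 1)) = 1"
    using emeasure_lborel_box[of k "k + 1"] emeasure_lborel_cbox[of k "k + 1"] one
    by (simp_all add: inner_add_left)
  ultimately show "emeasure lebesgue (floor_vec -` {k}) = 1"
    using borel by (simp add: antisym)
qed

lemma measurable_floor_vec: "floor_vec \<in> lebesgue \<rightarrow>\<^sub>M count_space int_lattice"
  using floor_vec_in_lattice sets_vimage_floor_vec
  by (auto simp: measurable_count_space_eq_countable[OF countable_int_lattice])

text \<open>The fibres of rounding are unit cubes, so rounding pushes Lebesgue measure forward to
  counting measure; lattice sums thereby become integrals.\<close>

lemma distr_floor_vec: "distr lebesgue (count_space int_lattice) floor_vec = count_space int_lattice"
proof (rule measure_eqI_countable[OF _ _ countable_int_lattice])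
  fix k :: "real^'a" assume k: "k \<in> int_lattice"
  then show "emeasure (distr lebesgue (count_space int_lattice) floor_vec) {k}
      = emeasure (count_space int_lattice) {k}"
    using emeasure_vimage_floor_vec[OF k] by (simp add: emeasure_distr[OF measurable_floor_vec])
qed auto

lemma
  fixes g :: "real^'d \<Rightarrow> real"
  assumes g: "integrable lebesgue (\<lambda>x. g (floor_vec x))"
  shows summable_on_int_lattice: "g summable_on int_lattice"
    and infsum_int_lattice: "(\<Sum>\<^sub>\<infinity>k\<in>int_lattice. g k) = (LINT x|lebesgue. g (floor_vec x))"
proof -
  have "integrable (distr lebesgue (count_space int_lattice) floor_vec) g"
    using g by (subst integrable_distr_eq[OF measurable_floor_vec]) auto
  then have sum: "Infinite_Set_Sum.abs_summable_on g int_lattice"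
    by (simp add: distr_floor_vec Infinite_Set_Sum.abs_summable_on_def)
  then show "g summable_on int_lattice"
    using abs_summable_equivalent abs_summable_summable by blast
  have "(\<Sum>\<^sub>\<infinity>k\<in>int_lattice. g k) = (LINT k|count_space int_lattice. g k)"
    using infsetsum_infsum[OF sum] by (simp add: infsetsum_def)
  also have "\<dots> = (LINT k|distr lebesgue (count_space int_lattice) floor_vec. g k)"
    by (simp add: distr_floor_vec)
  also have "\<dots> = (LINT x|lebesgue. g (floor_vec x))"
    by (rule integral_distr[OF measurable_floor_vec]) auto
  finally show "(\<Sum>\<^sub>\<infinity>k\<in>int_lattice. g k) = (LINT x|lebesgue. g (floor_vec x))" .
qed

subsection \<open>Comparison of lattice sums with moments\<close>

lemma (in log_concave_isotropic)
  shows integrable_affine_square: "integrable lebesgue (\<lambda>x. (v \<bullet> x + s)\<^sup>2 * f x)"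
    and integral_affine_square:
      "(LINT x|lebesgue. (v \<bullet> x + s)\<^sup>2 * f x) = (norm v)\<^sup>2 * \<sigma>\<^sup>2 + s\<^sup>2"
proof -
  have *: "(\<lambda>x. (v \<bullet> x + s)\<^sup>2 * f x) = (\<lambda>x. (v \<bullet> x)\<^sup>2 * f x + 2 * s * (v \<bullet> x * f x) + s\<^sup>2 * f x)"
    by (auto simp: power2_eq_square algebra_simps)
  show "integrable lebesgue (\<lambda>x. (v \<bullet> x + s)\<^sup>2 * f x)"
    unfolding * using integrable_square integrable_linear integrable_f by auto
  show "(LINT x|lebesgue. (v \<bullet> x + s)\<^sup>2 * f x) = (norm v)\<^sup>2 * \<sigma>\<^sup>2 + s\<^sup>2"
    unfolding * using integrable_square[of v] integrable_linear[of v] integrable_f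
    by (simp add: integral_f mean_zero second_moment)
qed

text \<open>Substitution in the unscaled formula, applied to \<open>v /\<^sub>R c\<close>.\<close>

lemma (in log_concave_isotropic)
  assumes c: "0 < c"
  shows integrable_affine_square_scaled: "integrable lebesgue (\<lambda>x. (v \<bullet> x + s)\<^sup>2 * f (c *\<^sub>R x))"
    and integral_affine_square_scaled: "(LINT x|lebesgue. (v \<bullet> x + s)\<^sup>2 * f (c *\<^sub>R x))
      = ((norm v)\<^sup>2 * \<sigma>\<^sup>2 / c\<^sup>2 + s\<^sup>2) / c ^ DIM('a)"
proof -
  have eq: "(v /\<^sub>R c) \<bullet> (0 + c *\<^sub>R x) = v \<bullet> x" for x using c by simp
  note int = integrable_affine_square[of "v /\<^sub>R c" s]
  show "integrable lebesgue (\<lambda>x. (v \<bullet> x + s)\<^sup>2 * f (c *\<^sub>R x))"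
    using integrable_lebesgue_affine[OF _ int, of c 0] c unfolding eq by simp
  show "(LINT x|lebesgue. (v \<bullet> x + s)\<^sup>2 * f (c *\<^sub>R x))
      = ((norm v)\<^sup>2 * \<sigma>\<^sup>2 / c\<^sup>2 + s\<^sup>2) / c ^ DIM('a)"
    using integral_lebesgue_affine[OF _ int, of c 0] c unfolding eq integral_affine_square
    by (simp add: power_divide power_mult_distrib power_inverse divide_inverse mult_ac)
qed

text \<open>Chosen so that \<open>\<epsilon> = contraction_const d / \<sigma>\<close> gives the
  admissible radius \<open>\<epsilon> * (mean_const d / 8 * \<sigma>) = d\<close>, which bounds
  every rounding vector.\<close>

definition contraction_const :: "nat \<Rightarrow> real"
  where "contraction_const d = 8 * real d / mean_const d"

text \<open>Collects the exponents of all relative errors, times \<sigma>: the contraction costs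
  \<open>\<epsilon> * \<bar>ln (level_const d)\<bar>\<close>, the scaling costs
  \<open>2 * \<epsilon>\<close> for each of \<open>d\<close> Jacobian powers and two moment powers,
  and the final \<open>1\<close> pays for rounding inside the square.\<close>

definition growth_const :: "nat \<Rightarrow> real" where
  "growth_const d = contraction_const d * (\<bar>ln (level_const d)\<bar> + 2 * real (d + 2)) + 1"

lemma contraction_const_nonneg: "0 \<le> contraction_const d"
  using mean_const_pos[of d] by (simp add: contraction_const_def)

lemma growth_const_ge: "1 \<le> growth_const d" "2 * contraction_const d \<le> growth_const d"
proof -
  have "contraction_const d * 2 \<le> contraction_const d * (\<bar>ln (level_const d)\<bar> + 2 * real (d + 2))"
    using contraction_const_nonneg by (intro mult_left_mono) auto
  then show "1 \<le> growth_const d" "2 * contraction_const d \<le> growth_const d"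
    using contraction_const_nonneg[of d] unfolding growth_const_def by auto
qed

text \<open>Young's inequality. With \<open>t = 1 / \<sigma>\<close> a bounded shift
  \<open>b\<close> costs a relative error \<open>1 / \<sigma>\<close> and an absolute error of order
  \<sigma>.\<close>

lemma square_add_le:
  fixes a b t :: real
  assumes "0 < t"
  shows "(a + b)\<^sup>2 \<le> (1 + t) * a\<^sup>2 + (1 + 1 / t) * b\<^sup>2"
proof -
  have "0 \<le> (t * a - b)\<^sup>2 / t" using assms by simp
  also have "\<dots> = (1 + t) * a\<^sup>2 + (1 + 1 / t) * b\<^sup>2 - (a + b)\<^sup>2"
    using assms by (simp add: power2_eq_square field_simps)
  finally show ?thesis by simp
qed

text \<open>Serves to bound \<open>1 / (1 - \<epsilon>)\<close> by
  \<open>exp (2 * \<epsilon>)\<close>.\<close>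

lemma exp_neg_le_one_minus:
  fixes x :: real
  assumes "0 \<le> x" "x \<le> 1/2"
  shows "exp (- (2 * x)) \<le> 1 - x"
proof -
  have "1 \<le> (1 - x) * (1 + 2 * x)"
  proof -
    have "0 \<le> x * (1 - 2 * x)" using assms by simp
    then show ?thesis by (simp add: algebra_simps)
  qed
  also have "\<dots> \<le> (1 - x) * exp (2 * x)"
    using assms exp_ge_add_one_self[of "2 * x"] by (intro mult_left_mono) auto
  finally show ?thesis by (simp add: exp_minus field_simps)
qed

locale log_concave_isotropic_lattice = log_concave_isotropic f \<sigma>
  for f :: "real^'d \<Rightarrow> real" and \<sigma> :: real +
  assumes \<sigma>_ge: "growth_const CARD('d) \<le> \<sigma>"
begin

definition "\<epsilon> = contraction_const CARD('d) / \<sigma>"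

lemma \<epsilon>_pos: "0 < \<epsilon>"
  using \<sigma>_pos mean_const_pos[of "CARD('d)"] by (simp add: \<epsilon>_def contraction_const_def)

lemma \<epsilon>_le: "\<epsilon> \<le> 1/2"
  using \<sigma>_pos \<sigma>_ge growth_const_ge(2)[of "CARD('d)"] by (simp add: \<epsilon>_def field_simps)

lemma \<sigma>_ge_1: "1 \<le> \<sigma>"
  using \<sigma>_ge growth_const_ge(1)[of "CARD('d)"] by simp

text \<open>The absolute value avoids a case distinction on the sign of the logarithm.\<close>

lemma contraction_bound_exp:
  assumes "norm u \<le> CARD('d)"
  shows "exp (- (\<epsilon> * \<bar>ln (level_const CARD('d))\<bar>)) * f x \<le> f ((1 - \<epsilon>) *\<^sub>R x + u)"
proof -
  have "\<epsilon> * (mean_const CARD('d) / 8 * \<sigma>) = CARD('d)"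
    using \<sigma>_pos mean_const_pos[of "CARD('d)"] by (simp add: \<epsilon>_def contraction_const_def)
  then have "level_const CARD('d) powr \<epsilon> * f x \<le> f ((1 - \<epsilon>) *\<^sub>R x + u)"
    using contraction_bound[of \<epsilon> u x] \<epsilon>_pos \<epsilon>_le assms by simp
  moreover have "exp (- (\<epsilon> * \<bar>ln (level_const CARD('d))\<bar>)) \<le> level_const CARD('d) powr \<epsilon>"
    using level_const_pos[of "CARD('d)"] \<epsilon>_pos
    by (simp add: powr_def abs_if mult_nonneg_nonpos mult_nonneg_nonneg)
  ultimately show ?thesis
    using nonneg by (meson mult_right_mono order_trans)
qed

text \<open>Contract from \<open>floor_vec x\<close> and correct by
  \<open>(1 - \<epsilon>) *\<^sub>R (x - floor_vec x)\<close>, which ends at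
  \<open>(1 - \<epsilon>) *\<^sub>R x\<close>.\<close>

lemma floor_vec_upper:
  "f (floor_vec x) \<le> exp (\<epsilon> * \<bar>ln (level_const CARD('d))\<bar>) * f ((1 - \<epsilon>) *\<^sub>R x)"
proof -
  have "norm ((1 - \<epsilon>) *\<^sub>R (x - floor_vec x)) \<le> 1 * norm (x - floor_vec x)"
    using \<epsilon>_pos \<epsilon>_le unfolding norm_scaleR by (intro mult_right_mono) auto
  then have "norm ((1 - \<epsilon>) *\<^sub>R (x - floor_vec x)) \<le> CARD('d)"
    using norm_diff_floor_vec[of x] by simp
  from contraction_bound_exp[OF this, of "floor_vec x"] show ?thesis
    by (simp add: scaleR_diff_right exp_minus field_simps)
qed

text \<open>Contract from \<open>x / (1 - \<epsilon>)\<close> to \<open>x\<close> and correct by the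
  rounding vector \<open>floor_vec x - x\<close>.\<close>

lemma floor_vec_lower:
  "exp (- (\<epsilon> * \<bar>ln (level_const CARD('d))\<bar>)) * f ((1 / (1 - \<epsilon>)) *\<^sub>R x) \<le> f (floor_vec x)"
  using contraction_bound_exp[of "floor_vec x - x" "(1 / (1 - \<epsilon>)) *\<^sub>R x"] norm_diff_floor_vec[of x] \<epsilon>_le
  by (simp add: norm_minus_commute)

text \<open>Young's inequality with \<open>t = 1 / \<sigma>\<close>, in both directions. The bound
  \<open>2\<close> on the norm accommodates the vectors
  \<open>axis i 1 \<plusminus> axis j 1\<close> of \<open>m2_bound\<close>.\<close>

lemma
  fixes v x :: "real^'d"
  assumes v: "norm v \<le> 2"
  shows affine_square_floor_vec_upper: "(v \<bullet> floor_vec x + s)\<^sup>2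
      \<le> (1 + 1 / \<sigma>) * (v \<bullet> x + s)\<^sup>2 + 8 * \<sigma> * (real CARD('d))\<^sup>2" (is ?u)
    and affine_square_floor_vec_lower: "(v \<bullet> x + s)\<^sup>2
      \<le> (1 + 1 / \<sigma>) * (v \<bullet> floor_vec x + s)\<^sup>2 + 8 * \<sigma> * (real CARD('d))\<^sup>2" (is ?l)
proof -
  define e where "e = v \<bullet> (x - floor_vec x)"
  have "\<bar>e\<bar> \<le> norm v * norm (x - floor_vec x)"
    unfolding e_def by (rule Cauchy_Schwarz_ineq2)
  also have "\<dots> \<le> 2 * real CARD('d)"
    using v norm_diff_floor_vec[of x] by (intro mult_mono) auto
  finally have "\<bar>e\<bar>\<^sup>2 \<le> (2 * real CARD('d))\<^sup>2" by (intro power_mono) auto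
  then have "e\<^sup>2 \<le> 4 * (real CARD('d))\<^sup>2" by (simp add: power_mult_distrib)
  then have "(1 + 1 / (1 / \<sigma>)) * e\<^sup>2 \<le> (2 * \<sigma>) * (4 * (real CARD('d))\<^sup>2)"
    using \<sigma>_ge_1 by (intro mult_mono) auto
  then have *: "(1 + 1 / (1 / \<sigma>)) * e\<^sup>2 \<le> 8 * \<sigma> * (real CARD('d))\<^sup>2" by simp
  have t: "0 < 1 / \<sigma>" using \<sigma>_pos by simp
  have 1: "v \<bullet> floor_vec x + s = (v \<bullet> x + s) + - e"
    and 2: "v \<bullet> x + s = (v \<bullet> floor_vec x + s) + e"
    by (auto simp: e_def inner_diff_right)
  show ?u
    unfolding 1 using square_add_le[OF t, of "v \<bullet> x + s" "- e"] * by simp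
  show ?l
    unfolding 2 using square_add_le[OF t, of "v \<bullet> floor_vec x + s" e] * by simp
qed

lemma exp_growth:
  "exp (\<epsilon> * \<bar>ln (level_const CARD('d))\<bar>) * exp (2 * \<epsilon>) ^ (CARD('d) + 2)
    = exp ((growth_const CARD('d) - 1) / \<sigma>)"
  unfolding exp_of_nat_mult[symmetric] exp_add[symmetric]
  by (simp add: growth_const_def \<epsilon>_def add_divide_distrib algebra_simps)

text \<open>The pointwise comparisons are integrated against rescaled copies of \<open>f\<close>,
  whose moments are explicit. In the lower bound the additive error \<open>R\<close> is multiplied
  by the lattice mass, which \<open>?le\<close> controls.\<close>

lemma integrable_floor_vec: "integrable lebesgue (\<lambda>x. f (floor_vec x))" (is ?int)
  and integral_floor_vec_le:
    "(LINT x|lebesgue. f (floor_vec x)) \<le> exp ((growth_const CARD('d) - 1) / \<sigma>)" (is ?le)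
  and integrable_affine_square_floor_vec:
    "norm v \<le> 2 \<Longrightarrow> integrable lebesgue (\<lambda>x. (v \<bullet> floor_vec x + s)\<^sup>2 * f (floor_vec x))"
    (is "_ \<Longrightarrow> ?int2")
  and integral_affine_square_floor_vec_le:
    "norm v \<le> 2 \<Longrightarrow> (LINT x|lebesgue. (v \<bullet> floor_vec x + s)\<^sup>2 * f (floor_vec x))
      \<le> exp (growth_const CARD('d) / \<sigma>)
        * ((norm v)\<^sup>2 * \<sigma>\<^sup>2 + s\<^sup>2 + 8 * \<sigma> * (real CARD('d))\<^sup>2)" (is "_ \<Longrightarrow> ?le2")
  and integral_affine_square_floor_vec_ge:
    "norm v \<le> 2 \<Longrightarrow> exp (- growth_const CARD('d) / \<sigma>) * ((norm v)\<^sup>2 * \<sigma>\<^sup>2 + s\<^sup>2)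
        - exp (growth_const CARD('d) / \<sigma>) * (8 * \<sigma> * (real CARD('d))\<^sup>2)
      \<le> (LINT x|lebesgue. (v \<bullet> floor_vec x + s)\<^sup>2 * f (floor_vec x))" (is "_ \<Longrightarrow> ?ge2")
proof -
  define d where "d = CARD('d)"
  define E where "E = exp (\<epsilon> * \<bar>ln (level_const CARD('d))\<bar>)"
  define a where "a = 1 - \<epsilon>"
  define R where "R = 8 * \<sigma> * (real CARD('d))\<^sup>2"
  define G where "G = exp ((growth_const CARD('d) - 1) / \<sigma>)"
  have R: "0 \<le> R" using \<sigma>_pos by (simp add: R_def)
  have E: "0 < E" by (simp add: E_def)
  have G: "0 < G" by (simp add: G_def)
  have a: "0 < a" "a \<le> 1" using \<epsilon>_pos \<epsilon>_le by (auto simp: a_def)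
  have inv_a: "1 \<le> 1 / a" using a by simp
  have meas: "(\<lambda>x. g (floor_vec x)) \<in> borel_measurable lebesgue" for g :: "real^'d \<Rightarrow> real"
    by (rule measurable_compose[OF measurable_floor_vec]) simp
  have EG: "E * (1 / a) ^ (d + 2) \<le> G"
  proof -
    have "1 / a \<le> exp (2 * \<epsilon>)"
      using exp_neg_le_one_minus[of \<epsilon>] \<epsilon>_pos \<epsilon>_le a(1)
      by (simp add: a_def exp_minus field_simps)
    then have "(1 / a) ^ (d + 2) \<le> exp (2 * \<epsilon>) ^ (d + 2)"
      using a by (intro power_mono) auto
    then have "E * (1 / a) ^ (d + 2) \<le> E * exp (2 * \<epsilon>) ^ (d + 2)"
      using E by (intro mult_left_mono) auto
    then show ?thesis unfolding E_def G_def d_def exp_growth .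
  qed
  have upper: "f (floor_vec x) \<le> E * f (a *\<^sub>R x)" for x
    using floor_vec_upper[of x] by (simp add: E_def a_def)
  \<comment> \<open>The mass is the second moment formula with \<open>v = 0\<close> and
    \<open>s = 1\<close>.\<close>
  have int_a: "integrable lebesgue (\<lambda>x. f (a *\<^sub>R x))"
    and eq_a: "(LINT x|lebesgue. f (a *\<^sub>R x)) = (1 / a) ^ d"
    using integrable_affine_square_scaled[OF a(1), of 0 1]
      integral_affine_square_scaled[OF a(1), of 0 1] by (simp_all add: d_def power_divide)
  show ?int
    by (rule Bochner_Integration.integrable_bound[OF integrable_mult_right[OF int_a, of E] meas])
      (use upper nonneg E in auto)
  then have "(LINT x|lebesgue. f (floor_vec x)) \<le> (LINT x|lebesgue. E * f (a *\<^sub>R x))"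
    using int_a upper by (intro integral_mono) auto
  also have "\<dots> = E * (1 / a) ^ d" by (simp add: eq_a)
  \<comment> \<open>Two spare factors \<open>1 / a \<ge> 1\<close> let the same \<open>G\<close>
    serve for mass and second moment.\<close>
  also have "\<dots> \<le> E * (1 / a) ^ (d + 2)"
    using E inv_a by (intro mult_left_mono power_increasing) auto
  also have "\<dots> \<le> G" by (rule EG)
  finally show le: ?le by (simp add: G_def)
  assume v: "norm v \<le> 2"
  define q where "q x = (v \<bullet> x + s)\<^sup>2" for x
  define Q where "Q = (norm v)\<^sup>2 * \<sigma>\<^sup>2 + s\<^sup>2"
  have Q: "0 \<le> Q" by (simp add: Q_def)
  have q: "0 \<le> q x" for x by (simp add: q_def)
  have t: "0 < 1 + 1 / \<sigma>" using \<sigma>_pos by (simp add: add_pos_pos)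
  have exp_t: "1 + 1 / \<sigma> \<le> exp (1 / \<sigma>)" by (rule exp_ge_add_one_self)
  have G_t: "G * exp (1 / \<sigma>) = exp (growth_const CARD('d) / \<sigma>)"
    by (simp add: G_def exp_add[symmetric] diff_divide_distrib)
  have int_q: "integrable lebesgue (\<lambda>x. q x * f (c *\<^sub>R x))"
    and eq_q: "(LINT x|lebesgue. q x * f (c *\<^sub>R x)) = ((norm v)\<^sup>2 * \<sigma>\<^sup>2 / c\<^sup>2 + s\<^sup>2) / c ^ d"
    if "0 < c" for c
    using integrable_affine_square_scaled[OF that, of v s]
      integral_affine_square_scaled[OF that, of v s] by (simp_all add: q_def d_def)
  define u where "u x = E * ((1 + 1 / \<sigma>) * (q x * f (a *\<^sub>R x)) + R * f (a *\<^sub>R x))" for x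
  have int_u: "integrable lebesgue u"
    unfolding u_def using int_q[OF a(1)] int_a by auto
  have q_le_u: "q (floor_vec x) * f (floor_vec x) \<le> u x" for x
  proof -
    have "q (floor_vec x) * f (floor_vec x) \<le> ((1 + 1 / \<sigma>) * q x + R) * (E * f (a *\<^sub>R x))"
      using affine_square_floor_vec_upper[OF v, of x s] upper[of x] nonneg t R
      by (intro mult_mono) (auto simp: q_def R_def)
    then show ?thesis by (simp add: u_def algebra_simps)
  qed
  have int2: "integrable lebesgue (\<lambda>x. q (floor_vec x) * f (floor_vec x))"
    by (rule Bochner_Integration.integrable_bound[OF int_u meas])
      (use q_le_u q nonneg in \<open>auto simp: abs_mult intro: order_trans[OF _ abs_ge_self]\<close>)
  then show ?int2 by (simp add: q_def)
  have "(LINT x|lebesgue. q (floor_vec x) * f (floor_vec x)) \<le> (LINT x|lebesgue. u x)"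
    using int2 int_u q_le_u by (intro integral_mono) auto
  also have "\<dots> = E * (1 / a) ^ d * ((1 + 1 / \<sigma>) * ((norm v)\<^sup>2 * \<sigma>\<^sup>2 * (1 / a)\<^sup>2 + s\<^sup>2) + R)"
    unfolding u_def using int_q[OF a(1)] int_a
    by (simp add: eq_q[OF a(1)] eq_a) (simp add: power_divide add_divide_distrib algebra_simps)
  also have "\<dots> \<le> E * (1 / a) ^ d * (exp (1 / \<sigma>) * ((1 / a)\<^sup>2 * (Q + R)))"
  proof (intro mult_left_mono)
    have a2: "1 \<le> (1 / a)\<^sup>2" using inv_a by (rule one_le_power)
    have "(norm v)\<^sup>2 * \<sigma>\<^sup>2 * (1 / a)\<^sup>2 + s\<^sup>2 \<le> (1 / a)\<^sup>2 * Q"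
      using mult_right_mono[OF a2, of "s\<^sup>2"] by (simp add: Q_def algebra_simps)
    then have "(1 + 1 / \<sigma>) * ((norm v)\<^sup>2 * \<sigma>\<^sup>2 * (1 / a)\<^sup>2 + s\<^sup>2) \<le> exp (1 / \<sigma>) * ((1 / a)\<^sup>2 * Q)"
      using exp_t by (intro mult_mono) auto
    moreover have "1 * (1 * R) \<le> exp (1 / \<sigma>) * ((1 / a)\<^sup>2 * R)"
      using a2 R \<sigma>_pos by (intro mult_mono) auto
    ultimately show "(1 + 1 / \<sigma>) * ((norm v)\<^sup>2 * \<sigma>\<^sup>2 * (1 / a)\<^sup>2 + s\<^sup>2) + R
        \<le> exp (1 / \<sigma>) * ((1 / a)\<^sup>2 * (Q + R))"
      by (simp add: algebra_simps)
  qed (use E a in auto)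
  also have "\<dots> = E * (1 / a) ^ (d + 2) * (exp (1 / \<sigma>) * (Q + R))"
    by (simp add: power_add power2_eq_square)
  also have "\<dots> \<le> G * (exp (1 / \<sigma>) * (Q + R))"
    using EG Q R by (intro mult_right_mono) auto
  finally show ?le2 using G_t by (simp add: Q_def R_def q_def mult.assoc[symmetric])
  have "1 / G * Q \<le> 1 / E * (a ^ d * ((norm v)\<^sup>2 * \<sigma>\<^sup>2 * a\<^sup>2 + s\<^sup>2))"
  proof -
    have a2: "a\<^sup>2 \<le> 1" using a by (simp add: power_le_one)
    have "a\<^sup>2 * Q \<le> (norm v)\<^sup>2 * \<sigma>\<^sup>2 * a\<^sup>2 + s\<^sup>2"
      using mult_right_mono[OF a2, of "s\<^sup>2"] by (simp add: Q_def algebra_simps)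
    then have "a ^ (d + 2) * Q \<le> a ^ d * ((norm v)\<^sup>2 * \<sigma>\<^sup>2 * a\<^sup>2 + s\<^sup>2)"
      using a by (simp add: power_add power2_eq_square mult.assoc mult_left_mono)
    moreover have "1 / G * Q \<le> a ^ (d + 2) / E * Q"
      using EG E G a Q by (intro mult_right_mono) (auto simp: field_simps)
    ultimately show ?thesis using E by (simp add: field_simps)
  qed
  also have "\<dots> = (LINT x|lebesgue. 1 / E * (q x * f ((1 / a) *\<^sub>R x)))"
    using a eq_q[of "1 / a"] by (simp add: power_divide field_simps)
  also have "\<dots> \<le> (LINT x|lebesgue. (1 + 1 / \<sigma>) * (q (floor_vec x) * f (floor_vec x)) + R * f (floor_vec x))"
  proof (intro integral_mono)
    fix x
    have "1 / E * (q x * f ((1 / a) *\<^sub>R x)) = q x * (1 / E * f ((1 / a) *\<^sub>R x))" by simp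
    also have "\<dots> \<le> ((1 + 1 / \<sigma>) * q (floor_vec x) + R) * f (floor_vec x)"
      using floor_vec_lower[of x] affine_square_floor_vec_lower[OF v, of x s] nonneg E q t R \<sigma>_pos
      by (intro mult_mono add_nonneg_nonneg mult_nonneg_nonneg)
        (auto simp: q_def R_def E_def a_def exp_minus field_simps)
    finally show "1 / E * (q x * f ((1 / a) *\<^sub>R x))
        \<le> (1 + 1 / \<sigma>) * (q (floor_vec x) * f (floor_vec x)) + R * f (floor_vec x)"
      by (simp add: algebra_simps)
  qed (use int_q[of "1 / a"] a int2 \<open>?int\<close> in auto)
  also have "\<dots> = (1 + 1 / \<sigma>) * (LINT x|lebesgue. q (floor_vec x) * f (floor_vec x))
      + R * (LINT x|lebesgue. f (floor_vec x))"
    using int2 \<open>?int\<close> by simp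
  also have "\<dots> \<le> exp (1 / \<sigma>) * (LINT x|lebesgue. q (floor_vec x) * f (floor_vec x)) + R * G"
    using exp_t le R q nonneg
    by (intro add_mono mult_right_mono mult_left_mono integral_nonneg_AE) (auto simp: G_def)
  finally have "1 / G * Q - R * G
      \<le> exp (1 / \<sigma>) * (LINT x|lebesgue. q (floor_vec x) * f (floor_vec x))" by simp
  then have "exp (- (1 / \<sigma>)) * (1 / G * Q - R * G)
      \<le> exp (- (1 / \<sigma>)) * (exp (1 / \<sigma>) * (LINT x|lebesgue. q (floor_vec x) * f (floor_vec x)))"
    by (intro mult_left_mono) auto
  also have "\<dots> = (LINT x|lebesgue. q (floor_vec x) * f (floor_vec x))"
    by (simp add: mult.assoc[symmetric] exp_add[symmetric])
  finally have low: "exp (- (1 / \<sigma>)) * (1 / G * Q - R * G)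
      \<le> (LINT x|lebesgue. q (floor_vec x) * f (floor_vec x))" .
  have 1: "exp (- (1 / \<sigma>)) * (1 / G) = exp (- growth_const CARD('d) / \<sigma>)"
    unfolding minus_divide_left[symmetric] exp_minus G_t[symmetric] by (simp add: field_simps)
  \<comment> \<open>This coefficient is subtracted, so enlarging it is harmless and makes it agree
    with the one in the upper bound.\<close>
  have "exp (- (1 / \<sigma>)) * G \<le> exp (1 / \<sigma>) * G"
    using G \<sigma>_pos by (intro mult_right_mono) auto
  also have "\<dots> = exp (growth_const CARD('d) / \<sigma>)"
    using G_t by (simp only: mult.commute)
  finally have 2: "exp (- (1 / \<sigma>)) * G * R \<le> exp (growth_const CARD('d) / \<sigma>) * R"
    using R by (rule mult_right_mono)
  have "exp (- (1 / \<sigma>)) * (1 / G * Q - R * G)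
      = exp (- (1 / \<sigma>)) * (1 / G) * Q - exp (- (1 / \<sigma>)) * G * R"
    by (simp only: right_diff_distrib mult.assoc mult.commute[of R])
  then have "exp (- growth_const CARD('d) / \<sigma>) * Q - exp (growth_const CARD('d) / \<sigma>) * R
      \<le> exp (- (1 / \<sigma>)) * (1 / G * Q - R * G)"
    using 2 unfolding 1 by linarith
  also note low
  finally show ?ge2 by (simp add: Q_def R_def q_def)
qed

end

section \<open>Discrete moments and the discrete covariance matrix\<close>

text \<open>\<open>10 = 2 * 5\<close> comes from \<open>exp g \<le> 1 + 2 * g\<close> and
  \<open>Q \<le> 5 * \<sigma>^2\<close>, and \<open>24 = 3 * 8\<close> from
  \<open>exp g \<le> 3\<close> and the \<open>8\<close> in \<open>R\<close>, as used in
  \<open>infsum_affine_square\<close>.\<close>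

definition error_const :: "nat \<Rightarrow> real"
  where "error_const d = 10 * growth_const d + 24 * (real d)\<^sup>2"

lemma error_const_pos: "0 < error_const d"
  using growth_const_ge(1)[of d] by (auto simp: error_const_def intro: add_pos_nonneg)

context log_concave_isotropic_lattice
begin

text \<open>The exponent \<open>g\<close> is of order \<open>1 / \<sigma>\<close> and the main term
  \<open>Q\<close> of order \<open>\<sigma>^2\<close>, so the relative error becomes an absolute
  error of order \<sigma>.\<close>

lemma
  assumes v: "norm v \<le> 2" and s: "\<bar>s\<bar> \<le> \<sigma>"
  shows summable_affine_square: "(\<lambda>k. (v \<bullet> k + s)\<^sup>2 * f k) summable_on int_lattice"
    and infsum_affine_square: "\<bar>(\<Sum>\<^sub>\<infinity>k\<in>int_lattice. (v \<bullet> k + s)\<^sup>2 * f k)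
      - ((norm v)\<^sup>2 * \<sigma>\<^sup>2 + s\<^sup>2)\<bar> \<le> error_const CARD('d) * \<sigma>"
proof -
  define g where "g = growth_const CARD('d) / \<sigma>"
  define Q where "Q = (norm v)\<^sup>2 * \<sigma>\<^sup>2 + s\<^sup>2"
  define R where "R = 8 * \<sigma> * (real CARD('d))\<^sup>2"
  define S where "S = (\<Sum>\<^sub>\<infinity>k\<in>int_lattice. (v \<bullet> k + s)\<^sup>2 * f k)"
  note int = integrable_affine_square_floor_vec[OF v, of s]
  show "(\<lambda>k. (v \<bullet> k + s)\<^sup>2 * f k) summable_on int_lattice"
    using summable_on_int_lattice[OF int] .
  have S: "S = (LINT x|lebesgue. (v \<bullet> floor_vec x + s)\<^sup>2 * f (floor_vec x))"
    unfolding S_def using infsum_int_lattice[OF int] .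
  have g: "0 \<le> g" "g \<le> 1"
    using \<sigma>_ge \<sigma>_pos growth_const_ge(1)[of "CARD('d)"] by (auto simp: g_def)
  have "(norm v)\<^sup>2 \<le> 2\<^sup>2" "\<bar>s\<bar>\<^sup>2 \<le> \<sigma>\<^sup>2"
    by (rule power_mono[OF v norm_ge_zero], rule power_mono[OF s abs_ge_zero])
  then have Q: "0 \<le> Q" "Q \<le> 5 * \<sigma>\<^sup>2"
    using mult_right_mono[of "(norm v)\<^sup>2" "2\<^sup>2" "\<sigma>\<^sup>2"] by (auto simp: Q_def)
  have R: "0 \<le> R" using \<sigma>_pos by (simp add: R_def)
  have g2: "g\<^sup>2 \<le> g" using g by (simp add: power2_eq_square mult_left_le)
  have e: "exp g \<le> 1 + 2 * g" using exp_bound[OF g] g2 by simp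
  have e': "1 - g \<le> exp (- g)" using exp_ge_add_one_self[of "- g"] by simp
  have "g * Q \<le> g * (5 * \<sigma>\<^sup>2)" using g Q by (intro mult_left_mono) auto
  also have "\<dots> = 5 * growth_const CARD('d) * \<sigma>"
    using \<sigma>_pos by (simp add: g_def power2_eq_square)
  finally have gQ: "g * Q \<le> 5 * growth_const CARD('d) * \<sigma>" .
  have gQ0: "0 \<le> g * Q" using g Q by simp
  have eR: "exp g * R \<le> 3 * R" using e g R by (intro mult_right_mono) auto
  have err: "error_const CARD('d) * \<sigma> = 2 * (5 * growth_const CARD('d) * \<sigma>) + 3 * R"
    by (simp add: error_const_def R_def algebra_simps)
  have "S \<le> exp g * (Q + R)"
    unfolding S Q_def R_def g_def using integral_affine_square_floor_vec_le[OF v, of s] .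
  also have "\<dots> = exp g * Q + exp g * R" by (simp add: algebra_simps)
  also have "exp g * Q \<le> (1 + 2 * g) * Q" using e Q by (intro mult_right_mono) auto
  finally have "S - Q \<le> error_const CARD('d) * \<sigma>" using eR gQ unfolding err by (simp add: algebra_simps)
  moreover have "exp (- g) * Q - exp g * R \<le> S"
    unfolding S Q_def R_def g_def using integral_affine_square_floor_vec_ge[OF v, of s] by simp
  moreover have "(1 - g) * Q \<le> exp (- g) * Q" using e' Q by (intro mult_right_mono) auto
  ultimately have "S - Q \<le> error_const CARD('d) * \<sigma>" "Q - S \<le> error_const CARD('d) * \<sigma>"
    using eR gQ gQ0 unfolding err by (auto simp: algebra_simps)
  then show "\<bar>S - Q\<bar> \<le> error_const CARD('d) * \<sigma>" by simp
qed

definition "m0 = (\<Sum>\<^sub>\<infinity>k\<in>int_lattice. f k)"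
definition "m1 i = (\<Sum>\<^sub>\<infinity>k\<in>int_lattice. k $ i * f k)"
definition "m2 i j = (\<Sum>\<^sub>\<infinity>k\<in>int_lattice. k $ i * k $ j * f k)"

text \<open>The case \<open>v = 0\<close>, \<open>s = \<sigma>\<close>, divided by
  \<open>\<sigma>^2\<close>.\<close>

lemma m0_bound: "\<bar>m0 - 1\<bar> \<le> error_const CARD('d) / \<sigma>"
proof -
  have "\<bar>\<sigma>\<^sup>2 * m0 - \<sigma>\<^sup>2\<bar> \<le> error_const CARD('d) * \<sigma>"
    using infsum_affine_square[of 0 \<sigma>] \<sigma>_pos unfolding m0_def
    by (simp add: infsum_cmult_right')
  also have "\<sigma>\<^sup>2 * m0 - \<sigma>\<^sup>2 = \<sigma>\<^sup>2 * (m0 - 1)" by (simp add: algebra_simps)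
  finally have "\<sigma>\<^sup>2 * \<bar>m0 - 1\<bar> \<le> error_const CARD('d) * \<sigma>" by (simp add: abs_mult)
  then show ?thesis using \<sigma>_pos by (simp add: power2_eq_square field_simps)
qed

lemma infsum_affine_square_diff:
  assumes "norm v \<le> 2" "norm w \<le> 2" "\<bar>s\<bar> \<le> \<sigma>" "\<bar>t\<bar> \<le> \<sigma>"
  shows "\<bar>(\<Sum>\<^sub>\<infinity>k\<in>int_lattice. ((v \<bullet> k + s)\<^sup>2 - (w \<bullet> k + t)\<^sup>2) * f k)
    - (((norm v)\<^sup>2 - (norm w)\<^sup>2) * \<sigma>\<^sup>2 + s\<^sup>2 - t\<^sup>2)\<bar> \<le> 2 * error_const CARD('d) * \<sigma>"
proof -
  let ?F = "\<lambda>k. (v \<bullet> k + s)\<^sup>2 * f k" and ?G = "\<lambda>k. (w \<bullet> k + t)\<^sup>2 * f k"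
  have "(\<lambda>k. - ?G k) summable_on int_lattice"
    using summable_affine_square[OF assms(2,4)] by (subst summable_on_uminus)
  from infsum_add[OF summable_affine_square[OF assms(1,3)] this]
  have "(\<Sum>\<^sub>\<infinity>k\<in>int_lattice. ((v \<bullet> k + s)\<^sup>2 - (w \<bullet> k + t)\<^sup>2) * f k)
      = infsum ?F int_lattice - infsum ?G int_lattice"
    by (simp add: infsum_uminus left_diff_distrib)
  moreover have "((norm v)\<^sup>2 - (norm w)\<^sup>2) * \<sigma>\<^sup>2 + s\<^sup>2 - t\<^sup>2
      = ((norm v)\<^sup>2 * \<sigma>\<^sup>2 + s\<^sup>2) - ((norm w)\<^sup>2 * \<sigma>\<^sup>2 + t\<^sup>2)"
    by (simp add: algebra_simps)
  ultimately show ?thesis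
    using infsum_affine_square[OF assms(1,3)] infsum_affine_square[OF assms(2,4)] by linarith
qed

text \<open>Polarization: \<open>(y + \<sigma>)^2 - (y - \<sigma>)^2 = 4 * \<sigma> * y\<close>. The
  large shift \<sigma> cancels the order of the error, so the first moments stay bounded.\<close>

lemma m1_bound: "\<bar>m1 i\<bar> \<le> error_const CARD('d) / 2"
proof -
  have "(\<lambda>k. ((axis i 1 \<bullet> k + \<sigma>)\<^sup>2 - (axis i 1 \<bullet> k + - \<sigma>)\<^sup>2) * f k) = (\<lambda>k. 4 * \<sigma> * (k $ i * f k))"
    by (auto simp: inner_axis' power2_eq_square algebra_simps)
  then have "\<bar>4 * \<sigma> * m1 i\<bar> \<le> 2 * error_const CARD('d) * \<sigma>"
    using infsum_affine_square_diff[of "axis i 1" "axis i 1" \<sigma> "- \<sigma>"] \<sigma>_pos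
    by (simp add: m1_def infsum_cmult_right')
  then show ?thesis using \<sigma>_pos by (simp add: abs_mult field_simps)
qed

text \<open>Polarization again, now with the sum and the difference of two unit vectors.\<close>

lemma m2_bound: "\<bar>m2 i j - \<sigma>\<^sup>2 * (if i = j then 1 else 0)\<bar> \<le> error_const CARD('d) * \<sigma> / 2"
proof -
  define v w :: "real^'d" where "v = axis i 1 + axis j 1" and "w = axis i 1 - axis j 1"
  have vw: "norm v \<le> 2" "norm w \<le> 2"
    unfolding v_def w_def
    using norm_triangle_ineq[of "axis i 1 :: real^'d" "axis j 1"]
      norm_triangle_ineq4[of "axis i 1 :: real^'d" "axis j 1"] by auto
  have "(norm v)\<^sup>2 - (norm w)\<^sup>2 = 4 * ((axis i 1 :: real^'d) \<bullet> axis j 1)"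
    unfolding v_def w_def power2_norm_eq_inner by (simp add: inner_simps inner_commute)
  then have n: "(norm v)\<^sup>2 - (norm w)\<^sup>2 = 4 * (if i = j then 1 else 0)"
    by (simp add: inner_axis_axis)
  have "(\<lambda>k. ((v \<bullet> k + 0)\<^sup>2 - (w \<bullet> k + 0)\<^sup>2) * f k) = (\<lambda>k. 4 * (k $ i * k $ j * f k))"
    by (auto simp: v_def w_def inner_axis' inner_add_left inner_diff_left power2_eq_square algebra_simps)
  then have "\<bar>4 * m2 i j - 4 * (if i = j then 1 else 0) * \<sigma>\<^sup>2\<bar> \<le> 2 * error_const CARD('d) * \<sigma>"
    using infsum_affine_square_diff[OF vw, of 0 0] \<sigma>_pos unfolding n m2_def
    by (simp add: infsum_cmult_right')
  moreover have "4 * m2 i j - 4 * (if i = j then 1 else 0) * \<sigma>\<^sup>2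
      = 4 * (m2 i j - \<sigma>\<^sup>2 * (if i = j then 1 else 0))" by (simp add: algebra_simps)
  ultimately have "4 * \<bar>m2 i j - \<sigma>\<^sup>2 * (if i = j then 1 else 0)\<bar> \<le> 2 * error_const CARD('d) * \<sigma>"
    by (simp only: abs_mult abs_numeral)
  moreover have "a \<le> b * \<sigma> / 2" if "4 * a \<le> 2 * b * \<sigma>" for a b :: real
    using that by (simp add: mult.commute)
  ultimately show ?thesis by blast
qed

lemma discrete_cov_bound:
  assumes \<sigma>: "2 * error_const CARD('d) \<le> \<sigma>"
  shows "\<bar>discrete_cov f $ i $ j - \<sigma>\<^sup>2 * (if i = j then 1 else 0)\<bar> \<le> 4 * error_const CARD('d) * \<sigma>"
proof -
  let ?D = "\<sigma>\<^sup>2 * (if i = j then 1 else 0) :: real"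
  have K: "0 < error_const CARD('d)" by (rule error_const_pos)
  have "error_const CARD('d) / \<sigma> \<le> 1/2" using \<sigma> \<sigma>_pos by (simp add: field_simps)
  then have m0: "1/2 \<le> m0" using m0_bound by linarith
  have "?D * \<bar>m0 - 1\<bar> \<le> \<sigma>\<^sup>2 * (error_const CARD('d) / \<sigma>)"
    using m0_bound by (intro mult_mono) auto
  then have "\<bar>?D * (m0 - 1)\<bar> \<le> error_const CARD('d) * \<sigma>"
    using \<sigma>_pos by (simp add: abs_mult power2_eq_square mult.commute)
  \<comment> \<open>Half of \<open>error_const CARD('d) * \<sigma>\<close> is the error of
    \<open>m2\<close>, one whole is the cost of inserting \<open>m0\<close>; dividing by
    \<open>m0 \<ge> 1/2\<close> then doubles the sum.\<close>
  then have num: "\<bar>m2 i j - ?D * m0\<bar> \<le> 3/2 * error_const CARD('d) * \<sigma>"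
    using m2_bound[of i j] unfolding right_diff_distrib by linarith
  have "\<bar>m2 i j / m0 - ?D\<bar> = \<bar>m2 i j - ?D * m0\<bar> / m0"
    using m0 by (simp add: abs_if field_simps)
  also have "\<dots> \<le> (3/2 * error_const CARD('d) * \<sigma>) / (1/2)"
    using m0 num K \<sigma>_pos by (intro frac_le) auto
  also have "\<dots> = 3 * error_const CARD('d) * \<sigma>" by simp
  finally have 1: "\<bar>m2 i j / m0 - ?D\<bar> \<le> 3 * error_const CARD('d) * \<sigma>" .
  have "\<bar>m1 i * m1 j / m0\<^sup>2\<bar> = \<bar>m1 i\<bar> * \<bar>m1 j\<bar> / m0\<^sup>2" by (simp add: abs_mult)
  also have "\<dots> \<le> (error_const CARD('d) / 2) * (error_const CARD('d) / 2) / (1/2)\<^sup>2"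
    using m0 K m1_bound by (intro frac_le mult_mono power_mono) auto
  also have "\<dots> = error_const CARD('d) * error_const CARD('d)" by (simp add: power2_eq_square)
  also have "\<dots> \<le> error_const CARD('d) * \<sigma>" using K \<sigma> by (intro mult_left_mono) auto
  finally have "\<bar>m1 i * m1 j / m0\<^sup>2\<bar> \<le> error_const CARD('d) * \<sigma>" .
  moreover have "discrete_cov f $ i $ j = m2 i j / m0 - m1 i * m1 j / m0\<^sup>2"
    by (simp add: discrete_cov_def m0_def m1_def m2_def)
  ultimately show ?thesis using 1 by linarith
qed

end

subsection \<open>Determinants\<close>

text \<open>Termwise comparison in the Leibniz expansion: each of the \<open>fact CARD('n)\<close>
  products changes by at most the same amount.\<close>

lemma det_near_scalar_matrix:
  fixes A :: "real^'n^'n" and \<sigma> B :: real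
  assumes \<sigma>: "0 < \<sigma>" "B \<le> \<sigma>"
    and A: "\<And>i j. \<bar>A $ i $ j - \<sigma>\<^sup>2 * (if i = j then 1 else 0)\<bar> \<le> B * \<sigma>"
  shows "\<bar>det A - \<sigma> ^ (2 * CARD('n))\<bar>
    \<le> fact CARD('n) * (2 ^ CARD('n) * (real CARD('n) * B)) * \<sigma> ^ (2 * CARD('n) - 1)"
proof -
  define n where "n = CARD('n)"
  \<comment> \<open>Dividing by \<open>2 * \<sigma>^2\<close> brings the entries of both matrices
    into \<open>[-1, 1]\<close>, as \<open>norm_prod_diff\<close> requires; the factor
    \<open>2\<close> suffices because \<open>B \<le> \<sigma>\<close>.\<close>
  define z w :: "'n \<Rightarrow> 'n \<Rightarrow> real"
    where "z i j = A $ i $ j / (2 * \<sigma>\<^sup>2)" and "w i j = (if i = j then 1 else 0) / 2" for i j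
  define D :: "real^'n^'n" where "D = (\<chi> i j. \<sigma>\<^sup>2 * (if i = j then 1 else 0))"
  have n: "0 < n" by (simp add: n_def)
  have B: "0 \<le> B" using A[of undefined undefined] \<sigma>(1)
    by (meson abs_ge_zero order_trans zero_le_mult_iff less_le_not_le)
  have zw: "\<bar>z i j - w i j\<bar> \<le> B / (2 * \<sigma>)" for i j
  proof -
    have "z i j - w i j = (A $ i $ j - \<sigma>\<^sup>2 * (if i = j then 1 else 0)) / (2 * \<sigma>\<^sup>2)"
      using \<sigma> by (simp add: z_def w_def field_simps)
    then have "\<bar>z i j - w i j\<bar> \<le> B * \<sigma> / (2 * \<sigma>\<^sup>2)"
      using A[of i j] \<sigma> by (simp add: divide_right_mono)
    also have "\<dots> = B / (2 * \<sigma>)" using \<sigma> by (simp add: power2_eq_square)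
    finally show ?thesis .
  qed
  have "B / (2 * \<sigma>) \<le> 1/2" using \<sigma> by (simp add: field_simps)
  then have w1: "norm (w i j) \<le> 1" and z1: "norm (z i j) \<le> 1" for i j
    using zw[of i j] by (auto simp: w_def split: if_splits)
  have prod: "\<bar>(\<Prod>i\<in>UNIV. A $ i $ p i) - (\<Prod>i\<in>UNIV. D $ i $ p i)\<bar>
      \<le> 2 ^ n * (real n * B) * \<sigma> ^ (2 * n - 1)" for p
  proof -
    have "(\<Prod>i\<in>UNIV. A $ i $ p i) = (2 * \<sigma>\<^sup>2) ^ n * (\<Prod>i\<in>UNIV. z i (p i))"
      "(\<Prod>i\<in>UNIV. D $ i $ p i) = (2 * \<sigma>\<^sup>2) ^ n * (\<Prod>i\<in>UNIV. w i (p i))"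
      unfolding n_def prod_constant[symmetric] prod.distrib[symmetric] using \<sigma>
      by (auto simp: z_def w_def D_def intro!: prod.cong)
    then have "\<bar>(\<Prod>i\<in>UNIV. A $ i $ p i) - (\<Prod>i\<in>UNIV. D $ i $ p i)\<bar>
        = (2 * \<sigma>\<^sup>2) ^ n * \<bar>(\<Prod>i\<in>UNIV. z i (p i)) - (\<Prod>i\<in>UNIV. w i (p i))\<bar>"
      by (simp add: right_diff_distrib[symmetric] abs_mult)
    also have "\<bar>(\<Prod>i\<in>UNIV. z i (p i)) - (\<Prod>i\<in>UNIV. w i (p i))\<bar> \<le> (\<Sum>i\<in>UNIV. \<bar>z i (p i) - w i (p i)\<bar>)"
      using norm_prod_diff[of UNIV "\<lambda>i. z i (p i)" "\<lambda>i. w i (p i)"] w1 z1 by simp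
    also have "\<dots> \<le> (\<Sum>i\<in>(UNIV::'n set). B / (2 * \<sigma>))" by (intro sum_mono zw)
    also have "\<dots> \<le> real n * B / \<sigma>"
      using B \<sigma> by (simp add: n_def field_simps)
    also have "(2 * \<sigma>\<^sup>2) ^ n * (real n * B / \<sigma>) = 2 ^ n * (real n * B) * \<sigma> ^ (2 * n - 1)"
    proof -
      \<comment> \<open>Positivity of \<open>n\<close> keeps the truncated subtraction
        exact.\<close>
      have "(\<sigma>\<^sup>2) ^ n = \<sigma> ^ Suc (2 * n - 1)" using n by (simp add: power_mult[symmetric])
      then show ?thesis using \<sigma> by (simp add: power_mult_distrib)
    qed
    finally show ?thesis by (simp add: mult_left_mono)
  qed
  have "det D = (\<Prod>i\<in>UNIV. D $ i $ i)" by (rule det_diagonal) (simp add: D_def)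
  also have "\<dots> = \<sigma> ^ (2 * n)" by (simp add: D_def n_def power_mult)
  finally have D: "det D = \<sigma> ^ (2 * n)" .
  have "det A - det D = (\<Sum>p\<in>{p. p permutes UNIV}. of_int (sign p) *
      ((\<Prod>i\<in>UNIV. A $ i $ p i) - (\<Prod>i\<in>UNIV. D $ i $ p i)))"
    by (simp add: det_def right_diff_distrib sum_subtractf)
  also have "\<bar>\<dots>\<bar> \<le> (\<Sum>p\<in>{p. p permutes (UNIV::'n set)}. 2 ^ n * (real n * B) * \<sigma> ^ (2 * n - 1))"
  proof (rule sum_abs[THEN order_trans], rule sum_mono)
    fix p :: "'n \<Rightarrow> 'n"
    have "\<bar>of_int (sign p) :: real\<bar> = 1" by (auto simp: sign_def)
    then show "\<bar>of_int (sign p) * ((\<Prod>i\<in>UNIV. A $ i $ p i) - (\<Prod>i\<in>UNIV. D $ i $ p i))\<bar>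
        \<le> 2 ^ n * (real n * B) * \<sigma> ^ (2 * n - 1)"
      using prod[of p] by (simp add: abs_mult)
  qed
  also have "\<dots> = fact n * (2 ^ n * (real n * B)) * \<sigma> ^ (2 * n - 1)"
    using card_permutations[of "UNIV :: 'n set" n] by (simp add: n_def)
  finally show ?thesis unfolding D n_def .
qed

theorem corollary33:
  shows "\<exists>C>0. \<exists>N>0. \<forall>(f :: real^'d::finite \<Rightarrow> real) (\<sigma> :: real).
    density_fun f \<longrightarrow> log_concave f \<longrightarrow> centered f \<longrightarrow> isotropic f \<longrightarrow>
    cov f = mat (\<sigma>\<^sup>2) \<longrightarrow> \<sigma> \<ge> N \<longrightarrow>
    \<bar>det (discrete_cov f) - \<sigma> ^ (2 * CARD('d))\<bar> \<le> C * \<sigma> ^ (2 * CARD('d) - 1)"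
proof -
  define K where "K = error_const CARD('d)"
  define C where "C = fact CARD('d) * (2 ^ CARD('d) * (real CARD('d) * (4 * K)))"
  have K: "0 < K" by (simp add: K_def error_const_pos)
  have growth: "growth_const CARD('d) \<le> K"
    using growth_const_ge(1)[of "CARD('d)"] zero_le_power2[of "real CARD('d)"]
    unfolding K_def error_const_def by linarith
  show ?thesis
  \<comment> \<open>\<open>C\<close> is the determinant constant for \<open>B = 4 * K\<close>. The
    threshold \<open>4 * K\<close> yields \<open>B \<le> \<sigma>\<close> as well as the lower
    bounds on \<sigma> required by the locale and by \<open>discrete_cov_bound\<close>.\<close>
  proof (rule exI[of _ C], intro conjI exI[of _ "4 * K"] allI impI)
    show "0 < C" "0 < 4 * K" using K by (auto simp: C_def)
    fix f :: "real^'d \<Rightarrow> real" and \<sigma> :: real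
    assume f: "density_fun f" "log_concave f" "centered f" "cov f = mat (\<sigma>\<^sup>2)" and \<sigma>: "4 * K \<le> \<sigma>"
    interpret log_concave_isotropic_lattice f \<sigma>
      using log_concave_isotropicI[OF f] \<sigma> K growth
      by (auto simp: log_concave_isotropic_lattice_def log_concave_isotropic_lattice_axioms_def)
    show "\<bar>det (discrete_cov f) - \<sigma> ^ (2 * CARD('d))\<bar> \<le> C * \<sigma> ^ (2 * CARD('d) - 1)"
      unfolding C_def using \<sigma> K discrete_cov_bound
      by (intro det_near_scalar_matrix) (auto simp: K_def)
  qed
qed

end
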